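(* Fix $n>1$ and $0<\epsilon\le 2$. There exists a constant $C>0$ such that for all $t\ge C\cdot\max\left(n^{2/3}\epsilon^{-4/3},\ \sqrt{n}\,\epsilon^{-2}\right)$, the 2-party closeness testing problem $\mathrm{CT}_{n,t,\epsilon}$ can be solved using $\tilde O\left(\frac{n^2}{t^2\epsilon^4}+1\right)$ bits of communication.
   Context: 2-party closeness testing $\mathrm{CT}_{n,t,\epsilon}$: Alice has $t$ i.i.d. samples from a distribution $a$ over $[n]$ and Bob has $t$ i.i.d. samples from a distribution $b$ over $[n]$; they must distinguish, with probability at least $2/3$, between $a=b$ and $\|a-b\|_1\ge\epsilon$. $\tilde O$ hides polylogarithmic factors. *)

theory Defs
  imports "HOL-Probability.Probability"
begin

text \<open>
  Two-party protocols as binary trees. At an inner node the designated party announces one bit,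
  a function of what that party holds (the earlier communication is encoded by the node);
  a leaf carries the answer, which is thus determined by the transcript and known to both parties.
\<close>

datatype ('x, 'y) protocol =
    Answer bool
  | Alice "'x \<Rightarrow> bool" "('x, 'y) protocol" "('x, 'y) protocol"
  | Bob "'y \<Rightarrow> bool" "('x, 'y) protocol" "('x, 'y) protocol"

primrec run :: "('x, 'y) protocol \<Rightarrow> 'x \<Rightarrow> 'y \<Rightarrow> bool" where
  "run (Answer v) x y = v"
| "run (Alice f P0 P1) x y = (if f x then run P1 x y else run P0 x y)"
| "run (Bob g P0 P1) x y = (if g y then run P1 x y else run P0 x y)"

text \<open>Number of bits communicated in the worst case over inputs and coins.\<close>

primrec comm_cost :: "('x, 'y) protocol \<Rightarrow> nat" where
  "comm_cost (Answer v) = 0"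
| "comm_cost (Alice f P0 P1) = Suc (max (comm_cost P0) (comm_cost P1))"
| "comm_cost (Bob g P0 P1) = Suc (max (comm_cost P0) (comm_cost P1))"

text \<open>
  Private coins: each party holds a pair of an input and a random string, and the two random
  strings are independent of each other and of the inputs. There is no shared randomness.
\<close>

type_synonym coins = "bool list"
type_synonym samples = "nat list"
type_synonym ct_protocol = "(samples \<times> coins, samples \<times> coins) protocol"

definition ct_answer ::
  "nat \<Rightarrow> coins pmf \<Rightarrow> coins pmf \<Rightarrow> ct_protocol \<Rightarrow> nat pmf \<Rightarrow> nat pmf \<Rightarrow> bool pmf" where
  "ct_answer t RA RB P a b =
     do {
       x \<leftarrow> replicate_pmf t a;
       y \<leftarrow> replicate_pmf t b;
       r \<leftarrow> RA;
       s \<leftarrow> RB;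
       return_pmf (run P (x, r) (y, s))
     }"

definition distribution_on :: "nat \<Rightarrow> nat pmf \<Rightarrow> bool" where
  "distribution_on n a \<longleftrightarrow> set_pmf a \<subseteq> {1..n}"

definition l1_dist :: "nat \<Rightarrow> nat pmf \<Rightarrow> nat pmf \<Rightarrow> real" where
  "l1_dist n a b = (\<Sum>i = 1..n. \<bar>pmf a i - pmf b i\<bar>)"

definition solves_CT ::
  "nat \<Rightarrow> nat \<Rightarrow> real \<Rightarrow> coins pmf \<Rightarrow> coins pmf \<Rightarrow> ct_protocol \<Rightarrow> bool" where
  "solves_CT n t \<epsilon> RA RB P \<longleftrightarrow>
     (\<forall>a b. distribution_on n a \<longrightarrow> distribution_on n b \<longrightarrow>
        (a = b \<longrightarrow> pmf (ct_answer t RA RB P a b) True \<ge> 2 / 3) \<and>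
        (l1_dist n a b \<ge> \<epsilon> \<longrightarrow> pmf (ct_answer t RA RB P a b) False \<ge> 2 / 3))"

definition CT_solvable_with :: "nat \<Rightarrow> nat \<Rightarrow> real \<Rightarrow> real \<Rightarrow> bool" where
  "CT_solvable_with n t \<epsilon> B \<longleftrightarrow>
     (\<exists>RA RB P. solves_CT n t \<epsilon> RA RB P \<and> real (comm_cost P) \<le> B)"

end

theory Submission
  imports Defs
begin

text \<open>
  Write \<open>\<delta> = a - b\<close>. Each party reveals \<open>k\<close> samples; with \<open>c i\<close> the number of times \<open>i\<close> is among these
  \<open>2k\<close> samples, coordinate \<open>i\<close> gets the weight \<open>w i \<approx> 1 / (1 + c i)\<close>. By Cauchy-Schwarz the weighted
  squared distance \<open>q = \<Sum> w i (\<delta> i)\<^sup>2\<close> is at least \<open>\<epsilon>\<^sup>2 / (n + 2k)\<close> if \<open>a\<close> and \<open>b\<close> are far apart, while the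
  weighted squared mass \<open>\<Sum> (w i (a i + b i))\<^sup>2\<close> has expectation \<open>O(1/k)\<close>.

  For the count vectors \<open>X, X'\<close> and \<open>Y, Y'\<close> of two fresh batches of \<open>h\<close> samples, the weighted inner product
  of \<open>X - Y\<close> and \<open>X' - Y'\<close> has expectation exactly \<open>h\<^sup>2 q\<close>, since the two vectors are independent. It is
  estimated by averaging \<open>m\<close> products of random-sign sketches, which Alice sends to Bob together with
  the seeds of the signs. Choosing \<open>k\<close> and \<open>m\<close> proportional to \<open>n\<^sup>2 / (h\<^sup>2 \<epsilon>\<^sup>4)\<close> makes both the sampling
  error and the sketching error small compared with \<open>h\<^sup>2 \<epsilon>\<^sup>2 / n\<close>, and \<open>h\<close> need never exceed \<open>O(n / \<epsilon>\<^sup>2)\<close>,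
  which keeps all transmitted numbers polynomial in \<open>n / \<epsilon>\<close>.
\<close>

section \<open>Announcing messages\<close>

text \<open>A protocol tree has no memory, so the announced bits are accumulated in the argument of
  the continuation \<open>Q\<close>, one copy of which is grafted below each bit string of length
  \<open>n\<close>.\<close>

primrec send_alice ::
  "nat \<Rightarrow> ('x \<Rightarrow> bool list) \<Rightarrow> (bool list \<Rightarrow> ('x, 'y) protocol) \<Rightarrow> ('x, 'y) protocol" where
  "send_alice 0 f Q = Q []"
| "send_alice (Suc n) f Q = Alice (\<lambda>x. hd (f x))
     (send_alice n (\<lambda>x. tl (f x)) (\<lambda>bs. Q (False # bs)))
     (send_alice n (\<lambda>x. tl (f x)) (\<lambda>bs. Q (True # bs)))"

lemma run_send_alice:
  "length (f x) = n \<Longrightarrow> run (send_alice n f Q) x y = run (Q (f x)) x y"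
proof (induction n arbitrary: f Q)
  case (Suc n)
  then obtain c bs where "f x = c # bs" "length bs = n" by (metis length_Suc_conv)
  then show ?case using Suc.IH[of "\<lambda>x. tl (f x)"] by (cases c) auto
qed simp

lemma comm_cost_send_alice:
  "(\<And>bs. comm_cost (Q bs) \<le> B) \<Longrightarrow> comm_cost (send_alice n f Q) \<le> n + B"
proof (induction n arbitrary: f Q)
  case (Suc n)
  show ?case
    using Suc.IH[of "\<lambda>bs. Q (False # bs)"] Suc.IH[of "\<lambda>bs. Q (True # bs)"] Suc.prems by simp
qed simp

text \<open>Carries the announcement lemma for Alice over to Bob.\<close>

primrec swap_roles :: "('x, 'y) protocol \<Rightarrow> ('y, 'x) protocol" where
  "swap_roles (Answer v) = Answer v"
| "swap_roles (Alice f P0 P1) = Bob f (swap_roles P0) (swap_roles P1)"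
| "swap_roles (Bob g P0 P1) = Alice g (swap_roles P0) (swap_roles P1)"

lemma run_swap_roles [simp]: "run (swap_roles P) y x = run P x y"
  by (induction P) auto

lemma comm_cost_swap_roles [simp]: "comm_cost (swap_roles P) = comm_cost P"
  by (induction P) auto

text \<open>\<open>S\<close> is embedded into the bit strings of length \<open>L\<close>. The length
  is fixed beforehand, so the cost bound holds on all inputs, while correctness is claimed only
  where the message lies in \<open>S\<close>.\<close>

lemma alice_announces:
  fixes f :: "'x \<Rightarrow> 'm" and Q :: "'m \<Rightarrow> ('x, 'y) protocol"
  assumes "finite S" "card S \<le> 2 ^ L" "\<And>v. comm_cost (Q v) \<le> B"
  obtains P where "comm_cost P \<le> L + B" "\<And>x y. f x \<in> S \<Longrightarrow> run P x y = run (Q (f x)) x y"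
proof -
  have "card S \<le> card {bs :: bool list. set bs \<subseteq> UNIV \<and> length bs = L}"
    using assms(2) by (simp only: card_lists_length_eq[OF finite]) simp
  then obtain enc where enc: "enc ` S \<subseteq> {bs :: bool list. set bs \<subseteq> UNIV \<and> length bs = L}" "inj_on enc S"
    using card_le_inj[OF assms(1) finite_lists_length_eq[OF finite]] by blast
  let ?P = "send_alice L (\<lambda>x. enc (f x)) (\<lambda>bs. Q (inv_into S enc bs))"
  show ?thesis
  proof (rule that[of ?P])
    show "comm_cost ?P \<le> L + B" by (rule comm_cost_send_alice) (rule assms(3))
    show "run ?P x y = run (Q (f x)) x y" if "f x \<in> S" for x y
      using that enc by (subst run_send_alice) auto
  qed
qed

lemma bob_announces:
  fixes f :: "'y \<Rightarrow> 'm" and Q :: "'m \<Rightarrow> ('x, 'y) protocol"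
  assumes "finite S" "card S \<le> 2 ^ L" "\<And>v. comm_cost (Q v) \<le> B"
  obtains P where "comm_cost P \<le> L + B" "\<And>x y. f y \<in> S \<Longrightarrow> run P x y = run (Q (f y)) x y"
proof -
  obtain P where P: "comm_cost P \<le> L + B"
    "\<And>y x. f y \<in> S \<Longrightarrow> run P y x = run (swap_roles (Q (f y))) y x"
    using alice_announces[OF assms(1,2), of "\<lambda>v. swap_roles (Q v)" B f] assms(3) by auto
  show ?thesis by (rule that[of "swap_roles P"]) (use P in auto)
qed

text \<open>Bob speaks first, because the weights in Alice's sketches will depend on the samples
  that he reveals. His closing bit puts the verdict into the transcript, from which a leaf has to
  read it.\<close>

lemma two_message_protocol:
  fixes f :: "'y \<Rightarrow> 'm" and g :: "'m \<Rightarrow> 'x \<Rightarrow> 'k" and h :: "'m \<Rightarrow> 'k \<Rightarrow> 'y \<Rightarrow> bool"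
  assumes "finite S" "card S \<le> 2 ^ L" "finite T" "card T \<le> 2 ^ M"
  obtains P where "comm_cost P \<le> L + (M + 1)"
    "\<And>x y. f y \<in> S \<Longrightarrow> g (f y) x \<in> T \<Longrightarrow> run P x y = h (f y) (g (f y) x) y"
proof -
  have "\<exists>P. comm_cost P \<le> M + 1 \<and> (\<forall>x y. g u x \<in> T \<longrightarrow> run P x y = h u (g u x) y)" for u
  proof -
    let ?Q = "\<lambda>v. Bob (h u v) (Answer False) (Answer True) :: ('x, 'y) protocol"
    obtain P where "comm_cost P \<le> M + 1"
      "\<And>x y. g u x \<in> T \<Longrightarrow> run P x y = run (?Q (g u x)) x y"
      using alice_announces[OF assms(3,4), of ?Q 1 "g u"] by auto
    then show ?thesis by (intro exI[of _ P]) simp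
  qed
  then obtain Q where Q: "\<And>u. comm_cost (Q u) \<le> M + 1"
    "\<And>u x y. g u x \<in> T \<Longrightarrow> run (Q u) x y = h u (g u x) y" by metis
  obtain P where "comm_cost P \<le> L + (M + 1)"
    "\<And>x y. f y \<in> S \<Longrightarrow> run P x y = run (Q (f y)) x y"
    using bob_announces[OF assms(1,2), where Q=Q, of "M + 1" f] Q(1) by blast
  with Q(2) show ?thesis using that by auto
qed

section \<open>Four-wise independent signs\<close>

text \<open>Subsets of \<open>{..<r}\<close> are the vectors of \<open>F_2^r\<close>, with
  \<open>sym_diff\<close> as addition. The choice is greedy: a new vector only has to avoid the sums
  of three earlier ones, of which there are at most \<open>card I ^ 3\<close>.\<close>

lemma sidon_family:
  fixes I :: "'a set"
  assumes "finite I" "card I ^ 3 < 2 ^ r"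
  shows "\<exists>v :: 'a \<Rightarrow> nat set. (\<forall>i\<in>I. v i \<subseteq> {..<r}) \<and>
    (\<forall>i\<in>I. \<forall>j\<in>I. \<forall>k\<in>I. \<forall>l\<in>I. sym_diff (v i) (v j) = sym_diff (v k) (v l) \<longrightarrow>
      (i = j \<and> k = l) \<or> (i = k \<and> j = l) \<or> (i = l \<and> j = k))"
  using assms
proof (induction I rule: finite_induct)
  case empty
  then show ?case by simp
next
  case (insert x I)
  have "card I ^ 3 \<le> card (insert x I) ^ 3"
    by (intro power_mono card_mono) (use insert in auto)
  with insert.prems have c: "card I ^ 3 < 2 ^ r" by linarith
  from insert.IH[OF c] obtain v :: "'a \<Rightarrow> nat set" where v: "\<forall>i\<in>I. v i \<subseteq> {..<r}"
    and inj: "\<forall>i\<in>I. \<forall>j\<in>I. \<forall>k\<in>I. \<forall>l\<in>I. sym_diff (v i) (v j) = sym_diff (v k) (v l) \<longrightarrow>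
      (i = j \<and> k = l) \<or> (i = k \<and> j = l) \<or> (i = l \<and> j = k)"
    by (elim exE conjE)
  define F where "F = (\<lambda>(i, j, k). sym_diff (v i) (sym_diff (v j) (v k))) ` (I \<times> I \<times> I)"
  have "card F \<le> card (I \<times> I \<times> I)"
    unfolding F_def by (rule card_image_le) (use insert.hyps in auto)
  also have "\<dots> < card (Pow {..<r})"
    using c by (simp add: card_cartesian_product card_Pow power3_eq_cube)
  finally have "card F < card (Pow {..<r})" .
  moreover have "finite F" unfolding F_def using insert.hyps by simp
  ultimately have "\<not> Pow {..<r} \<subseteq> F" by (meson card_mono leD)
  then obtain a where a: "a \<subseteq> {..<r}" "a \<notin> F" by blast
  have aF: "a \<noteq> sym_diff (v i) (sym_diff (v j) (v k))" if "i \<in> I" "j \<in> I" "k \<in> I" for i j k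
    using a(2) that unfolding F_def by force
  \<comment> \<open>Over \<open>F_2\<close> the sum of three copies of \<open>v i\<close> is
    \<open>v i\<close> itself, so avoiding threefold sums also keeps the family injective.\<close>
  have av: "a \<noteq> v i" if "i \<in> I" for i
    using aF[OF that that that] by simp
  define v' where "v' = v(x := a)"
  have v'x: "v' x = a" by (simp add: v'_def)
  have v'I: "v' i = v i" if "i \<in> I" for i
    using insert.hyps that by (auto simp: v'_def)
  have inj': "i = j" if "i \<in> insert x I" "j \<in> insert x I" "v' i = v' j" for i j
  proof (cases "i = x \<or> j = x")
    case True
    then show ?thesis using that av insert.hyps by (auto simp: v'_def split: if_splits)
  next
    case False
    then have ij: "i \<in> I" "j \<in> I" using that by auto
    then have "v i = v j" using that v'I by simp
    then show ?thesis using inj[rule_format, of i j i i] ij by auto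
  qed
  have cancel: "sym_diff A B = sym_diff A D \<Longrightarrow> B = D" for A B D :: "nat set" by blast
  have comm: "sym_diff A B = sym_diff B A" for A B :: "nat set" by blast
  \<comment> \<open>In a relation between four vectors each is the sum of the other three. With four
    distinct indices, one of them \<open>x\<close>, this would put \<open>a\<close> into
    \<open>F\<close>.\<close>
  have solve: "A = sym_diff B (sym_diff C D)" "B = sym_diff A (sym_diff C D)"
    "C = sym_diff A (sym_diff B D)" "D = sym_diff A (sym_diff B C)"
    if "sym_diff A B = sym_diff C D" for A B C D :: "nat set"
    using that by blast+
  have "(i = j \<and> k = l) \<or> (i = k \<and> j = l) \<or> (i = l \<and> j = k)"
    if *: "i \<in> insert x I" "j \<in> insert x I" "k \<in> insert x I" "l \<in> insert x I"
      and e: "sym_diff (v' i) (v' j) = sym_diff (v' k) (v' l)" for i j k l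
  proof (cases "i = j \<or> i = k \<or> i = l \<or> j = k \<or> j = l \<or> k = l")
    case True
    then consider "i = j" | "i = k" | "i = l" | "j = k" | "j = l" | "k = l" by blast
    then show ?thesis
    proof cases
      case 1
      with e have "v' k = v' l" by blast
      with 1 inj' * show ?thesis by blast
    next
      case 2
      with cancel[of "v' i" "v' j" "v' l"] e have "v' j = v' l" by simp
      with 2 inj' * show ?thesis by blast
    next
      case 3
      with cancel[of "v' i" "v' j" "v' k"] comm[of "v' k" "v' i"] e have "v' j = v' k" by simp
      with 3 inj' * show ?thesis by blast
    next
      case 4
      with cancel[of "v' j" "v' i" "v' l"] comm[of "v' i" "v' j"] e have "v' i = v' l" by simp
      with 4 inj' * show ?thesis by blast
    next
      case 5
      with cancel[of "v' j" "v' i" "v' k"] comm[of "v' i" "v' j"] comm[of "v' k" "v' j"] e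
      have "v' i = v' k" by simp
      with 5 inj' * show ?thesis by blast
    next
      case 6
      with e have "v' i = v' j" by blast
      with 6 inj' * show ?thesis by blast
    qed
  next
    case False
    then consider "i = x" "j \<in> I" "k \<in> I" "l \<in> I" | "j = x" "i \<in> I" "k \<in> I" "l \<in> I"
      | "k = x" "i \<in> I" "j \<in> I" "l \<in> I" | "l = x" "i \<in> I" "j \<in> I" "k \<in> I"
      | "i \<in> I" "j \<in> I" "k \<in> I" "l \<in> I" using * by auto
    then show ?thesis
    proof cases
      case 1
      then show ?thesis using solve(1)[OF e] aF by (simp add: v'x v'I)
    next
      case 2
      then show ?thesis using solve(2)[OF e] aF by (simp add: v'x v'I)
    next
      case 3
      then show ?thesis using solve(3)[OF e] aF by (simp add: v'x v'I)
    next
      case 4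
      then show ?thesis using solve(4)[OF e] aF by (simp add: v'x v'I)
    next
      case 5
      then show ?thesis using e inj by (simp add: v'I)
    qed
  qed
  moreover have "\<forall>i\<in>insert x I. v' i \<subseteq> {..<r}"
    using v a by (auto simp: v'_def)
  ultimately show ?case by (intro exI[of _ v']) blast
qed

text \<open>In \<open>F_2^r\<close> this is the character with index \<open>s\<close> at the vector
  \<open>A\<close>: \<open>-1\<close> to the power of their inner product.\<close>

definition sgn_set :: "nat set \<Rightarrow> nat set \<Rightarrow> real" where
  "sgn_set s A = (-1) ^ card (s \<inter> A)"

text \<open>Elements of \<open>s \<inter> A \<inter> B\<close> are counted twice on the left and
  cancel modulo 2.\<close>

lemma sgn_set_mult:
  assumes "finite A" "finite B"
  shows "sgn_set s A * sgn_set s B = sgn_set s (sym_diff A B)"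
proof -
  have "s \<inter> sym_diff A B = (s \<inter> A - s \<inter> A \<inter> B) \<union> (s \<inter> B - s \<inter> A \<inter> B)" by blast
  also have "card \<dots> = card (s \<inter> A - s \<inter> A \<inter> B) + card (s \<inter> B - s \<inter> A \<inter> B)"
    by (rule card_Un_disjoint) (use assms in auto)
  finally have 1: "card (s \<inter> sym_diff A B) =
    card (s \<inter> A - s \<inter> A \<inter> B) + card (s \<inter> B - s \<inter> A \<inter> B)" .
  have 2: "card (s \<inter> A) = card (s \<inter> A - s \<inter> A \<inter> B) + card (s \<inter> A \<inter> B)"
    by (subst card_Un_disjoint[symmetric]) (use assms in \<open>auto intro: arg_cong[where f=card]\<close>)
  have 3: "card (s \<inter> B) = card (s \<inter> B - s \<inter> A \<inter> B) + card (s \<inter> A \<inter> B)"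
    by (subst card_Un_disjoint[symmetric]) (use assms in \<open>auto intro: arg_cong[where f=card]\<close>)
  show ?thesis
    unfolding sgn_set_def power_add[symmetric] 1 2 3 by (simp add: power_add)
qed

text \<open>Toggling a fixed element \<open>e\<close> of \<open>A\<close> in \<open>s\<close> is an
  involution of \<open>Pow R\<close> that flips every sign.\<close>

lemma sum_sgn_set:
  assumes "A \<subseteq> R" "finite R" "A \<noteq> {}"
  shows "(\<Sum>s\<in>Pow R. sgn_set s A) = 0"
proof -
  obtain e where e: "e \<in> A" using assms by blast
  have eq: "sgn_set (sym_diff s {e}) A = - sgn_set s A" if "s \<in> Pow R" for s
  proof -
    have fin: "finite s" using that assms finite_subset by auto
    \<comment> \<open>\<open>sgn_set\<close> is symmetric in its two arguments, so multiplicativity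
      can be used in the seed.\<close>
    have "sgn_set A s * sgn_set A {e} = sgn_set A (sym_diff s {e})"
      by (rule sgn_set_mult) (use fin in auto)
    then show ?thesis using e by (simp add: sgn_set_def Int_commute)
  qed
  have "(\<Sum>s\<in>Pow R. sgn_set s A) = (\<Sum>s\<in>Pow R. sgn_set (sym_diff s {e}) A)"
  proof (rule sum.reindex_bij_witness[where i="\<lambda>s. sym_diff s {e}" and j="\<lambda>s. sym_diff s {e}"])
    have inv: "sym_diff (sym_diff s {e}) {e} = s" for s :: "nat set" by blast
    fix s assume s: "s \<in> Pow R"
    show "sym_diff (sym_diff s {e}) {e} = s" by (fact inv)
    show "sym_diff (sym_diff s {e}) {e} = s" by (fact inv)
    show "sgn_set (sym_diff (sym_diff s {e}) {e}) A = sgn_set s A" by (simp only: inv)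
    show "sym_diff s {e} \<in> Pow R" using s e assms(1) by blast
    then show "sym_diff s {e} \<in> Pow R" .
  qed
  also have "\<dots> = (\<Sum>s\<in>Pow R. - sgn_set s A)" by (rule sum.cong) (use eq in auto)
  finally show ?thesis by (simp add: sum_negf)
qed

section \<open>Signs from uniformly random seeds\<close>

definition seeds :: "nat \<Rightarrow> nat set pmf" where
  "seeds r = pmf_of_set (Pow {..<r})"

lemma set_seeds: "set_pmf (seeds r) = Pow {..<r}"
  unfolding seeds_def by (rule set_pmf_of_set) auto

lemma finite_set_seeds [simp]: "finite (set_pmf (seeds r))"
  by (simp add: set_seeds)

lemma expectation_sgn_set:
  assumes "A \<subseteq> {..<r}"
  shows "measure_pmf.expectation (seeds r) (\<lambda>s. sgn_set s A) = of_bool (A = {})"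
proof -
  have "measure_pmf.expectation (seeds r) (\<lambda>s. sgn_set s A) = (\<Sum>s\<in>Pow {..<r}. sgn_set s A) / card (Pow {..<r})"
    unfolding seeds_def by (rule integral_pmf_of_set) auto
  also have "\<dots> = of_bool (A = {})"
    using sum_sgn_set[OF assms] by (cases "A = {}") (auto simp: sgn_set_def card_Pow)
  finally show ?thesis .
qed

text \<open>Only fourfold products of the signs enter the analysis, so their independence up to order
  four is all that is required, and seeds of logarithmic length suffice for it.\<close>

lemma four_wise_signs:
  fixes I :: "'a set"
  assumes "finite I" "card I ^ 3 < 2 ^ r"
  obtains \<sigma> :: "nat set \<Rightarrow> 'a \<Rightarrow> real" where
    "\<And>s i. \<sigma> s i \<in> {-1, 1}"
    "\<And>i j. i \<in> I \<Longrightarrow> j \<in> I \<Longrightarrow>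
       measure_pmf.expectation (seeds r) (\<lambda>s. \<sigma> s i * \<sigma> s j) = of_bool (i = j)"
    "\<And>i j k l. i \<in> I \<Longrightarrow> j \<in> I \<Longrightarrow> k \<in> I \<Longrightarrow> l \<in> I \<Longrightarrow>
       measure_pmf.expectation (seeds r) (\<lambda>s. \<sigma> s i * \<sigma> s j * (\<sigma> s k * \<sigma> s l)) =
       of_bool ((i = j \<and> k = l) \<or> (i = k \<and> j = l) \<or> (i = l \<and> j = k))"
proof -
  from sidon_family[OF assms] obtain v :: "'a \<Rightarrow> nat set" where v: "\<forall>i\<in>I. v i \<subseteq> {..<r}"
    and inj: "\<forall>i\<in>I. \<forall>j\<in>I. \<forall>k\<in>I. \<forall>l\<in>I. sym_diff (v i) (v j) = sym_diff (v k) (v l) \<longrightarrow>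
      (i = j \<and> k = l) \<or> (i = k \<and> j = l) \<or> (i = l \<and> j = k)"
    by (elim exE conjE)
  have fin: "finite (v i)" if "i \<in> I" for i using v that finite_subset by blast
  show ?thesis
  proof (rule that[of "\<lambda>s i. sgn_set s (v i)"])
    fix s i
    show "sgn_set s (v i) \<in> {-1, 1}"
      by (cases "even (card (s \<inter> v i))") (auto simp: sgn_set_def)
  next
    fix i j assume ij: "i \<in> I" "j \<in> I"
    have "sym_diff (v i) (v j) = {} \<longleftrightarrow> i = j"
      using inj[rule_format, of i j i i] ij by auto
    then show "measure_pmf.expectation (seeds r) (\<lambda>s. sgn_set s (v i) * sgn_set s (v j)) = of_bool (i = j)"
      using v ij fin by (subst sgn_set_mult) (auto simp: expectation_sgn_set subset_iff)
  next
    fix i j k l assume ijkl: "i \<in> I" "j \<in> I" "k \<in> I" "l \<in> I"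
    have "sym_diff (sym_diff (v i) (v j)) (sym_diff (v k) (v l)) = {} \<longleftrightarrow>
        (i = j \<and> k = l) \<or> (i = k \<and> j = l) \<or> (i = l \<and> j = k)"
      using inj[rule_format, of i j k l] ijkl by blast
    moreover have "sym_diff (sym_diff (v i) (v j)) (sym_diff (v k) (v l)) \<subseteq> {..<r}"
      using v ijkl by blast
    ultimately show "measure_pmf.expectation (seeds r)
        (\<lambda>s. sgn_set s (v i) * sgn_set s (v j) * (sgn_set s (v k) * sgn_set s (v l))) =
       of_bool ((i = j \<and> k = l) \<or> (i = k \<and> j = l) \<or> (i = l \<and> j = k))"
      using ijkl fin by (simp only: sgn_set_mult expectation_sgn_set finite_Un finite_Diff)
  qed
qed

text \<open>Two of the three pairings of the indices hold together only if all four agree, so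
  inclusion-exclusion writes the indicator as the sum of the pairings minus twice the full diagonal.
  The pairings contribute \<open>|u|^2 |v|^2\<close> once and \<open><u, v>^2\<close> twice;
  Cauchy-Schwarz bounds the latter, and the diagonal is dropped for its sign.\<close>

lemma quadruple_sum_le:
  fixes u v :: "'a \<Rightarrow> real"
  assumes "finite I"
  shows "(\<Sum>i\<in>I. \<Sum>j\<in>I. \<Sum>k\<in>I. \<Sum>l\<in>I. u i * u j * (v k * v l) *
      of_bool ((i = j \<and> k = l) \<or> (i = k \<and> j = l) \<or> (i = l \<and> j = k))) \<le>
    3 * ((\<Sum>i\<in>I. (u i)\<^sup>2) * (\<Sum>i\<in>I. (v i)\<^sup>2))"
proof -
  have ind: "(of_bool ((i = j \<and> k = l) \<or> (i = k \<and> j = l) \<or> (i = l \<and> j = k)) :: real) =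
    of_bool (i = j) * of_bool (k = l) + of_bool (i = k) * of_bool (j = l)
     + of_bool (i = l) * of_bool (j = k) - 2 * (of_bool (i = j) * of_bool (k = l) * of_bool (i = k))" for i j k l :: 'a
    by auto
  have "(\<Sum>i\<in>I. \<Sum>j\<in>I. \<Sum>k\<in>I. \<Sum>l\<in>I. u i * u j * (v k * v l) *
      of_bool ((i = j \<and> k = l) \<or> (i = k \<and> j = l) \<or> (i = l \<and> j = k))) =
    (\<Sum>i\<in>I. \<Sum>j\<in>I. \<Sum>k\<in>I. \<Sum>l\<in>I. u i * u j * (v k * v l) * (of_bool (i = j) * of_bool (k = l)))
    + (\<Sum>i\<in>I. \<Sum>j\<in>I. \<Sum>k\<in>I. \<Sum>l\<in>I. u i * u j * (v k * v l) * (of_bool (i = k) * of_bool (j = l)))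
    + (\<Sum>i\<in>I. \<Sum>j\<in>I. \<Sum>k\<in>I. \<Sum>l\<in>I. u i * u j * (v k * v l) * (of_bool (i = l) * of_bool (j = k)))
    - 2 * (\<Sum>i\<in>I. \<Sum>j\<in>I. \<Sum>k\<in>I. \<Sum>l\<in>I. u i * u j * (v k * v l) * (of_bool (i = j) * of_bool (k = l) * of_bool (i = k)))"
    unfolding ind by (simp add: algebra_simps sum.distrib sum_subtractf sum_distrib_left)
  also have "(\<Sum>i\<in>I. \<Sum>j\<in>I. \<Sum>k\<in>I. \<Sum>l\<in>I. u i * u j * (v k * v l) * (of_bool (i = j) * of_bool (k = l)))
     = (\<Sum>i\<in>I. (u i)\<^sup>2) * (\<Sum>i\<in>I. (v i)\<^sup>2)"
  proof -
    have "(\<Sum>l\<in>I. u i * u j * (v k * v l) * (of_bool (i = j) * of_bool (k = l)))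
        = u i * u j * of_bool (i = j) * (v k)\<^sup>2" if "k \<in> I" for i j k
      using that assms by (subst sum.remove[of _ k]) (auto simp: power2_eq_square intro!: sum.neutral)
    then have "(\<Sum>i\<in>I. \<Sum>j\<in>I. \<Sum>k\<in>I. \<Sum>l\<in>I. u i * u j * (v k * v l) * (of_bool (i = j) * of_bool (k = l)))
      = (\<Sum>i\<in>I. \<Sum>j\<in>I. u i * u j * of_bool (i = j) * (\<Sum>k\<in>I. (v k)\<^sup>2))"
      by (simp add: sum_distrib_left)
    also have "(\<Sum>j\<in>I. u i * u j * of_bool (i = j) * S) = (u i)\<^sup>2 * S" if "i \<in> I" for i S
      using that assms by (subst sum.remove[of _ i]) (auto simp: power2_eq_square intro!: sum.neutral)
    then have "(\<Sum>i\<in>I. \<Sum>j\<in>I. u i * u j * of_bool (i = j) * (\<Sum>k\<in>I. (v k)\<^sup>2)) =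
      (\<Sum>i\<in>I. (u i)\<^sup>2) * (\<Sum>i\<in>I. (v i)\<^sup>2)" by (simp add: sum_distrib_right)
    finally show ?thesis .
  qed
  also have "(\<Sum>i\<in>I. \<Sum>j\<in>I. \<Sum>k\<in>I. \<Sum>l\<in>I. u i * u j * (v k * v l) * (of_bool (i = k) * of_bool (j = l)))
     = (\<Sum>i\<in>I. u i * v i)\<^sup>2"
  proof -
    have "(\<Sum>l\<in>I. u i * u j * (v k * v l) * (of_bool (i = k) * of_bool (j = l)))
        = (u i * v k * of_bool (i = k)) * (u j * v j)" if "j \<in> I" for i j k
      using that assms by (subst sum.remove[of _ j]) (auto intro!: sum.neutral)
    then have "(\<Sum>i\<in>I. \<Sum>j\<in>I. \<Sum>k\<in>I. \<Sum>l\<in>I. u i * u j * (v k * v l) * (of_bool (i = k) * of_bool (j = l)))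
      = (\<Sum>i\<in>I. \<Sum>j\<in>I. \<Sum>k\<in>I. (u i * v k * of_bool (i = k)) * (u j * v j))" by simp
    also have "(\<Sum>k\<in>I. (u i * v k * of_bool (i = k)) * S) = u i * v i * S" if "i \<in> I" for i S
      using that assms by (subst sum.remove[of _ i]) (auto intro!: sum.neutral)
    then have "(\<Sum>i\<in>I. \<Sum>j\<in>I. \<Sum>k\<in>I. (u i * v k * of_bool (i = k)) * (u j * v j))
      = (\<Sum>i\<in>I. u i * v i)\<^sup>2" by (simp add: power2_eq_square sum_product)
    finally show ?thesis .
  qed
  also have "(\<Sum>i\<in>I. \<Sum>j\<in>I. \<Sum>k\<in>I. \<Sum>l\<in>I. u i * u j * (v k * v l) * (of_bool (i = l) * of_bool (j = k)))
     = (\<Sum>i\<in>I. u i * v i)\<^sup>2"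
  proof -
    have "(\<Sum>l\<in>I. u i * u j * (v k * v l) * (of_bool (i = l) * of_bool (j = k)))
        = (u j * v k * of_bool (j = k)) * (u i * v i)" if "i \<in> I" for i j k
      using that assms by (subst sum.remove[of _ i]) (auto intro!: sum.neutral)
    then have "(\<Sum>i\<in>I. \<Sum>j\<in>I. \<Sum>k\<in>I. \<Sum>l\<in>I. u i * u j * (v k * v l) * (of_bool (i = l) * of_bool (j = k)))
      = (\<Sum>i\<in>I. \<Sum>j\<in>I. \<Sum>k\<in>I. (u j * v k * of_bool (j = k)) * (u i * v i))" by simp
    also have "(\<Sum>k\<in>I. (u j * v k * of_bool (j = k)) * S) = u j * v j * S" if "j \<in> I" for j S
      using that assms by (subst sum.remove[of _ j]) (auto intro!: sum.neutral)
    then have "(\<Sum>i\<in>I. \<Sum>j\<in>I. \<Sum>k\<in>I. (u j * v k * of_bool (j = k)) * (u i * v i))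
      = (\<Sum>i\<in>I. u i * v i)\<^sup>2" by (simp add: power2_eq_square sum_product mult.commute)
    finally show ?thesis .
  qed
  also have "(\<Sum>i\<in>I. \<Sum>j\<in>I. \<Sum>k\<in>I. \<Sum>l\<in>I. u i * u j * (v k * v l) *
      (of_bool (i = j) * of_bool (k = l) * of_bool (i = k))) = (\<Sum>i\<in>I. (u i * v i)\<^sup>2)"
  proof -
    have "(\<Sum>l\<in>I. u i * u j * (v k * v l) * (of_bool (i = j) * of_bool (k = l) * of_bool (i = k)))
        = u i * u j * of_bool (i = j) * ((v k)\<^sup>2 * of_bool (i = k))" if "k \<in> I" for i j k
      using that assms by (subst sum.remove[of _ k]) (auto simp: power2_eq_square intro!: sum.neutral)
    then have "(\<Sum>i\<in>I. \<Sum>j\<in>I. \<Sum>k\<in>I. \<Sum>l\<in>I. u i * u j * (v k * v l) * (of_bool (i = j) * of_bool (k = l) * of_bool (i = k)))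
      = (\<Sum>i\<in>I. \<Sum>j\<in>I. \<Sum>k\<in>I. u i * u j * of_bool (i = j) * ((v k)\<^sup>2 * of_bool (i = k)))" by simp
    also have "(\<Sum>k\<in>I. S * ((v k)\<^sup>2 * of_bool (i = k))) = S * (v i)\<^sup>2" if "i \<in> I" for i S
      using that assms by (subst sum.remove[of _ i]) (auto intro!: sum.neutral)
    then have "(\<Sum>i\<in>I. \<Sum>j\<in>I. \<Sum>k\<in>I. u i * u j * of_bool (i = j) * ((v k)\<^sup>2 * of_bool (i = k)))
      = (\<Sum>i\<in>I. \<Sum>j\<in>I. u i * u j * of_bool (i = j) * (v i)\<^sup>2)" by simp
    also have "(\<Sum>j\<in>I. u i * u j * of_bool (i = j) * S) = (u i)\<^sup>2 * S" if "i \<in> I" for i S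
      using that assms by (subst sum.remove[of _ i]) (auto simp: power2_eq_square intro!: sum.neutral)
    then have "(\<Sum>i\<in>I. \<Sum>j\<in>I. u i * u j * of_bool (i = j) * (v i)\<^sup>2) = (\<Sum>i\<in>I. (u i * v i)\<^sup>2)"
      by (simp add: power_mult_distrib)
    finally show ?thesis .
  qed
  finally have eq: "(\<Sum>i\<in>I. \<Sum>j\<in>I. \<Sum>k\<in>I. \<Sum>l\<in>I. u i * u j * (v k * v l) *
      of_bool ((i = j \<and> k = l) \<or> (i = k \<and> j = l) \<or> (i = l \<and> j = k))) =
    (\<Sum>i\<in>I. (u i)\<^sup>2) * (\<Sum>i\<in>I. (v i)\<^sup>2) + (\<Sum>i\<in>I. u i * v i)\<^sup>2 + (\<Sum>i\<in>I. u i * v i)\<^sup>2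
      - 2 * (\<Sum>i\<in>I. (u i * v i)\<^sup>2)" .
  have "(\<Sum>i\<in>I. u i * v i)\<^sup>2 \<le> (\<Sum>i\<in>I. (u i)\<^sup>2) * (\<Sum>i\<in>I. (v i)\<^sup>2)"
    by (rule Cauchy_Schwarz_ineq_sum)
  moreover have "0 \<le> (\<Sum>i\<in>I. (u i * v i)\<^sup>2)" by (intro sum_nonneg) auto
  ultimately show ?thesis unfolding eq by linarith
qed

section \<open>Means of finitely supported distributions\<close>

abbreviation mean :: "'a pmf \<Rightarrow> ('a \<Rightarrow> real) \<Rightarrow> real" where
  "mean p f \<equiv> measure_pmf.expectation p f"

lemma mean_bind:
  assumes "finite (set_pmf p)" "\<And>x. x \<in> set_pmf p \<Longrightarrow> finite (set_pmf (f x))"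
  shows "mean (bind_pmf p f) h = mean p (\<lambda>x. mean (f x) h)"
  using assms by (simp add: pmf_expectation_bind[of "set_pmf p"] integral_measure_pmf[of "set_pmf p"])

lemma mean_pair:
  assumes "finite (set_pmf p)" "finite (set_pmf q)"
  shows "mean (pair_pmf p q) f = mean p (\<lambda>x. mean q (\<lambda>y. f (x, y)))"
  unfolding pair_pmf_def using assms by (simp add: mean_bind)

lemma mean_eq_sum:
  assumes "finite I" "set_pmf p \<subseteq> I"
  shows "mean p f = (\<Sum>i\<in>I. pmf p i * f i)"
  using assms by (subst integral_measure_pmf[of I]) auto

lemma mean_cong: "(\<And>x. x \<in> set_pmf p \<Longrightarrow> f x = g x) \<Longrightarrow> mean p f = mean p g"
  by (intro integral_cong_AE) (auto simp: AE_measure_pmf_iff)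

lemma mean_mono:
  assumes "finite (set_pmf p)" "\<And>x. x \<in> set_pmf p \<Longrightarrow> f x \<le> g x"
  shows "mean p f \<le> mean p g"
  using assms by (intro integral_mono_AE integrable_measure_pmf_finite) (auto simp: AE_measure_pmf_iff)

lemma mean_add:
  "finite (set_pmf p) \<Longrightarrow> mean p (\<lambda>x. f x + g x) = mean p f + mean p g"
  by (intro Bochner_Integration.integral_add integrable_measure_pmf_finite)

lemma mean_diff:
  "finite (set_pmf p) \<Longrightarrow> mean p (\<lambda>x. f x - g x) = mean p f - mean p g"
  by (intro Bochner_Integration.integral_diff integrable_measure_pmf_finite)

lemma mean_sum:
  "finite (set_pmf p) \<Longrightarrow> mean p (\<lambda>x. \<Sum>i\<in>I. f i x) = (\<Sum>i\<in>I. mean p (f i))"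
  by (intro Bochner_Integration.integral_sum integrable_measure_pmf_finite)

lemma finite_replicate_pmf [simp]:
  "finite (set_pmf p) \<Longrightarrow> finite (set_pmf (replicate_pmf n p))"
  by (induction n) auto

lemma replicate_pmf_Suc_map:
  "replicate_pmf (Suc n) p = map_pmf (\<lambda>(x, xs). x # xs) (pair_pmf p (replicate_pmf n p))"
  by (simp add: pair_pmf_def map_bind_pmf map_pmf_def bind_assoc_pmf bind_return_pmf)

lemma mean_sum_list:
  assumes "finite (set_pmf p)"
  shows "mean (replicate_pmf n p) (\<lambda>xs. sum_list (map f xs) - n * mean p f) = 0"
proof (induction n)
  case (Suc n)
  have "mean (replicate_pmf (Suc n) p) (\<lambda>xs. sum_list (map f xs) - Suc n * mean p f) =
    mean p (\<lambda>x. mean (replicate_pmf n p)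
      (\<lambda>xs. (f x - mean p f) + (sum_list (map f xs) - n * mean p f)))"
    unfolding replicate_pmf_Suc_map using assms by (simp add: mean_pair algebra_simps)
  also have "\<dots> = 0"
    using assms Suc by (simp only: mean_add finite_replicate_pmf) (simp add: mean_diff)
  finally show ?case .
qed simp

text \<open>When one sample is split off, the cross term vanishes because the centred sum of the
  others has mean zero. Each sample thus adds its variance, which is at most its second
  moment.\<close>

lemma mean_sum_list_square:
  assumes "finite (set_pmf p)"
  shows "mean (replicate_pmf n p) (\<lambda>xs. (sum_list (map f xs) - n * mean p f)\<^sup>2) \<le> n * mean p (\<lambda>x. (f x)\<^sup>2)"
proof (induction n)
  case (Suc n)
  define \<mu> where "\<mu> = mean p f"
  define T where "T = (\<lambda>xs. sum_list (map f xs) - n * \<mu>)"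
  have fin: "finite (set_pmf (replicate_pmf n p))" using assms by simp
  have T0: "mean (replicate_pmf n p) T = 0"
    using mean_sum_list[OF assms, of n f] unfolding T_def \<mu>_def .
  have eq: "(sum_list (map f (x # xs)) - Suc n * \<mu>)\<^sup>2 =
     (f x - \<mu>)\<^sup>2 + (2 * (f x - \<mu>) * T xs + (T xs)\<^sup>2)" for x xs
    by (simp add: T_def power2_eq_square algebra_simps)
  have "mean (replicate_pmf (Suc n) p) (\<lambda>xs. (sum_list (map f xs) - Suc n * \<mu>)\<^sup>2) =
    mean p (\<lambda>x. mean (replicate_pmf n p) (\<lambda>xs. (sum_list (map f (x # xs)) - Suc n * \<mu>)\<^sup>2))"
    unfolding replicate_pmf_Suc_map using assms by (simp add: mean_pair del: sum_list.Cons list.map)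
  also have "\<dots> = mean p (\<lambda>x. (f x - \<mu>)\<^sup>2 + mean (replicate_pmf n p) (\<lambda>xs. (T xs)\<^sup>2))"
    unfolding eq by (simp add: mean_add[OF fin] T0)
  also have "\<dots> = mean p (\<lambda>x. (f x - \<mu>)\<^sup>2) + mean (replicate_pmf n p) (\<lambda>xs. (T xs)\<^sup>2)"
    using assms by (simp add: mean_add)
  also have "mean p (\<lambda>x. (f x - \<mu>)\<^sup>2) = mean p (\<lambda>x. (f x)\<^sup>2 - (2 * \<mu> * f x - \<mu>\<^sup>2))"
    by (simp add: power2_eq_square algebra_simps)
  also have "\<dots> = mean p (\<lambda>x. (f x)\<^sup>2) - \<mu>\<^sup>2"
    using assms by (simp add: mean_diff \<mu>_def power2_eq_square)
  finally have "mean (replicate_pmf (Suc n) p) (\<lambda>xs. (sum_list (map f xs) - Suc n * \<mu>)\<^sup>2) =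
    mean p (\<lambda>x. (f x)\<^sup>2) - \<mu>\<^sup>2 + mean (replicate_pmf n p) (\<lambda>xs. (T xs)\<^sup>2)" .
  moreover have "mean (replicate_pmf n p) (\<lambda>xs. (T xs)\<^sup>2) \<le> n * mean p (\<lambda>x. (f x)\<^sup>2)"
    using Suc unfolding T_def \<mu>_def .
  moreover have "Suc n * mean p (\<lambda>x. (f x)\<^sup>2) = mean p (\<lambda>x. (f x)\<^sup>2) + n * mean p (\<lambda>x. (f x)\<^sup>2)"
    by (simp add: algebra_simps)
  ultimately show ?case unfolding \<mu>_def[symmetric] using zero_le_power2[of \<mu>] by linarith
qed simp

section \<open>Counts of a symbol as binomial variables\<close>

lemma map_count_replicate_pmf:
  "map_pmf (\<lambda>xs. count_list xs i) (replicate_pmf n a) = binomial_pmf n (pmf a i)"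
proof (induction n)
  case 0
  then show ?case by (simp add: binomial_pmf_0 pmf_le_1)
next
  case (Suc n)
  have b: "bernoulli_pmf (pmf a i) = map_pmf (\<lambda>x. x = i) a"
  proof (rule pmf_eqI)
    fix c
    have "pmf (map_pmf (\<lambda>x. x = i) a) True = pmf a i"
      by (simp add: pmf_map vimage_def measure_pmf_single)
    then show "pmf (bernoulli_pmf (pmf a i)) c = pmf (map_pmf (\<lambda>x. x = i) a) c"
      by (cases c) (simp_all add: pmf_False_conv_True pmf_le_1)
  qed
  show ?case
    by (subst binomial_pmf_Suc) (auto simp: pmf_le_1 b Suc[symmetric] map_pmf_def bind_assoc_pmf
      bind_return_pmf intro!: bind_pmf_cong)
qed

text \<open>The identity \<open>(n + 1) * (n choose k) = (k + 1) * (Suc n choose Suc k)\<close>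
  turns the left side into the binomial expansion of \<open>(p + (1 - p)) ^ Suc n\<close> without
  its term for exponent 0 of \<open>p\<close>. The product form also covers
  \<open>pmf a i = 0\<close>.\<close>

lemma mean_inverse_count:
  "mean (replicate_pmf n a) (\<lambda>xs. 1 / (1 + real (count_list xs i))) * ((n + 1) * pmf a i) \<le> 1"
proof -
  define p where "p = pmf a i"
  have p: "p \<in> {0..1}" by (simp add: p_def pmf_le_1)
  have "mean (replicate_pmf n a) (\<lambda>xs. 1 / (1 + real (count_list xs i))) =
     mean (map_pmf (\<lambda>xs. count_list xs i) (replicate_pmf n a)) (\<lambda>k. 1 / (1 + real k))"
    by simp
  also have "\<dots> = (\<Sum>k\<le>n. real (n choose k) * p ^ k * (1 - p) ^ (n - k) * (1 / (1 + real k)))"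
    unfolding map_count_replicate_pmf p_def[symmetric] by (subst expectation_binomial_pmf'[OF p]) simp
  finally have "mean (replicate_pmf n a) (\<lambda>xs. 1 / (1 + real (count_list xs i))) * ((n + 1) * p) =
    (\<Sum>k\<le>n. (real (n + 1) * real (n choose k) / (1 + real k)) * p ^ (k + 1) * (1 - p) ^ (n - k))"
    by (simp add: sum_distrib_right sum_distrib_left field_simps)
  also have "\<dots> = (\<Sum>k\<le>n. real (Suc n choose Suc k) * p ^ Suc k * (1 - p) ^ (Suc n - Suc k))"
  proof (rule sum.cong[OF refl])
    fix k
    have "real (Suc k) * real (Suc n choose Suc k) = real (Suc n) * real (n choose k)"
      by (metis Suc_times_binomial of_nat_mult)
    then have "real (n + 1) * real (n choose k) / (1 + real k) = real (Suc n choose Suc k)"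
      by (simp add: field_simps)
    then show "(real (n + 1) * real (n choose k) / (1 + real k)) * p ^ (k + 1) * (1 - p) ^ (n - k) =
      real (Suc n choose Suc k) * p ^ Suc k * (1 - p) ^ (Suc n - Suc k)" by simp
  qed
  also have "\<dots> \<le> (\<Sum>k\<le>Suc n. real (Suc n choose k) * p ^ k * (1 - p) ^ (Suc n - k))"
    using p by (subst sum.atMost_Suc_shift) auto
  also have "\<dots> = (p + (1 - p)) ^ Suc n" by (subst binomial_ring) simp
  finally show ?thesis by (simp add: p_def add.commute)
qed

section \<open>The sketched statistic\<close>

definition batch :: "nat \<Rightarrow> 'a pmf \<Rightarrow> 'a pmf \<Rightarrow> ('a list \<times> 'a list) pmf" where
  "batch h a b = pair_pmf (replicate_pmf h a) (replicate_pmf h b)"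

text \<open>Written with sums over the two sample lists, so that each party can evaluate its own
  half.\<close>

definition lin :: "('a \<Rightarrow> real) \<Rightarrow> 'a list \<times> 'a list \<Rightarrow> real" where
  "lin u z = sum_list (map u (fst z)) - sum_list (map u (snd z))"

text \<open>Coordinate \<open>i\<close> of the count difference \<open>X - Y\<close>.\<close>

definition cdiff :: "'a list \<times> 'a list \<Rightarrow> 'a \<Rightarrow> real" where
  "cdiff z i = real (count_list (fst z) i) - real (count_list (snd z) i)"

text \<open>The products are summed, not averaged; their number reappears as a factor of the mean
  and of the threshold.\<close>

definition sketch_stat ::
  "('s \<Rightarrow> 'a \<Rightarrow> real) \<Rightarrow> 's list \<Rightarrow> 'a list \<times> 'a list \<Rightarrow> 'a list \<times> 'a list \<Rightarrow> real" where
  "sketch_stat \<phi> ss z z' = sum_list (map (\<lambda>s. lin (\<phi> s) z * lin (\<phi> s) z') ss)"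

lemma square_add_le: "(x + y)\<^sup>2 \<le> 2 * x\<^sup>2 + 2 * (y :: real)\<^sup>2"
  using zero_le_power2[of "x - y"] by (simp add: power2_eq_square algebra_simps)

lemma square_diff_le: "(x - y)\<^sup>2 \<le> 2 * x\<^sup>2 + 2 * (y :: real)\<^sup>2"
  using square_add_le[of x "- y"] by simp

lemma square_add3_le: "(x + y + z)\<^sup>2 \<le> 3 * x\<^sup>2 + 3 * y\<^sup>2 + 3 * (z :: real)\<^sup>2"
  using zero_le_power2[of "x - y"] zero_le_power2[of "x - z"] zero_le_power2[of "y - z"]
  by (simp add: power2_eq_square algebra_simps)

lemma sum_list_map_eq_sum_count_real:
  fixes u :: "'a \<Rightarrow> real"
  assumes "finite I" "set xs \<subseteq> I"
  shows "sum_list (map u xs) = (\<Sum>i\<in>I. u i * real (count_list xs i))"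
  using assms(2)
proof (induction xs)
  case (Cons x xs)
  have "(\<Sum>i\<in>I. u i * real (count_list (x # xs) i)) =
      (\<Sum>i\<in>I. u i * of_bool (x = i) + u i * real (count_list xs i))"
    by (intro sum.cong) (auto simp: algebra_simps)
  also have "\<dots> = (\<Sum>i\<in>I. u i * of_bool (x = i)) + (\<Sum>i\<in>I. u i * real (count_list xs i))"
    by (rule sum.distrib)
  also have "(\<Sum>i\<in>I. u i * of_bool (x = i)) = u x"
    using Cons.prems assms(1) by (subst sum.remove[of _ x]) (auto intro!: sum.neutral)
  finally show ?case using Cons by simp
qed simp

section \<open>Moments of count differences and of their sketches\<close>

locale two_sources =
  fixes I :: "'a set" and a b :: "'a pmf"
  assumes finite_I: "finite I" and supp_a: "set_pmf a \<subseteq> I" and supp_b: "set_pmf b \<subseteq> I"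
begin

definition \<delta> :: "'a \<Rightarrow> real" where "\<delta> i = pmf a i - pmf b i"
definition \<rho> :: "'a \<Rightarrow> real" where "\<rho> i = pmf a i + pmf b i"

lemma finite_supp [simp]: "finite (set_pmf a)" "finite (set_pmf b)"
  using finite_I supp_a supp_b finite_subset by auto

lemma finite_batch [simp]: "finite (set_pmf (batch h a b))"
  by (simp add: batch_def)

lemma rho_nonneg: "0 \<le> \<rho> i"
  by (simp add: \<rho>_def)

lemma sum_rho: "(\<Sum>i\<in>I. \<rho> i) = 2"
  using sum_pmf_eq_1[OF finite_I supp_a] sum_pmf_eq_1[OF finite_I supp_b]
  by (simp add: \<rho>_def sum.distrib)

lemma batch_supp:
  assumes "z \<in> set_pmf (batch h a b)"
  shows "set (fst z) \<subseteq> I" "set (snd z) \<subseteq> I"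
  using assms supp_a supp_b by (auto simp: batch_def set_replicate_pmf)

lemma lin_eq:
  assumes "z \<in> set_pmf (batch h a b)"
  shows "lin u z = (\<Sum>i\<in>I. u i * cdiff z i)"
  unfolding lin_def cdiff_def
  using sum_list_map_eq_sum_count_real[OF finite_I batch_supp(1)[OF assms], of u]
    sum_list_map_eq_sum_count_real[OF finite_I batch_supp(2)[OF assms], of u]
  by (simp add: sum_subtractf[symmetric] algebra_simps)

text \<open>The deviations of the two parties' sums are joined by \<open>square_diff_le\<close>,
  which replaces an appeal to their independence at the price of a factor 2.\<close>

lemma lin_variance:
  "mean (batch h a b) (\<lambda>z. (lin u z - real h * (\<Sum>i\<in>I. u i * \<delta> i))\<^sup>2) \<le> 2 * real h * (\<Sum>i\<in>I. (u i)\<^sup>2 * \<rho> i)"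
proof -
  let ?A = "\<lambda>xs. (sum_list (map u xs) - real h * mean a u)\<^sup>2"
  let ?B = "\<lambda>xs. (sum_list (map u xs) - real h * mean b u)\<^sup>2"
  have \<mu>: "(\<Sum>i\<in>I. u i * \<delta> i) = mean a u - mean b u"
    by (simp add: mean_eq_sum[OF finite_I supp_a] mean_eq_sum[OF finite_I supp_b] \<delta>_def
        sum_subtractf[symmetric] algebra_simps)
  have "(lin u z - real h * (\<Sum>i\<in>I. u i * \<delta> i))\<^sup>2 \<le> 2 * ?A (fst z) + 2 * ?B (snd z)" for z
    using square_diff_le[of "sum_list (map u (fst z)) - real h * mean a u" "sum_list (map u (snd z)) - real h * mean b u"]
    unfolding lin_def \<mu> by (simp add: algebra_simps)
  then have "mean (batch h a b) (\<lambda>z. (lin u z - real h * (\<Sum>i\<in>I. u i * \<delta> i))\<^sup>2) \<le>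
    mean (batch h a b) (\<lambda>z. 2 * ?A (fst z) + 2 * ?B (snd z))"
    by (intro mean_mono) auto
  also have "\<dots> = 2 * mean (replicate_pmf h a) ?A + 2 * mean (replicate_pmf h b) ?B"
    unfolding batch_def by (simp add: mean_pair mean_add)
  also have "\<dots> \<le> 2 * (real h * mean a (\<lambda>i. (u i)\<^sup>2)) + 2 * (real h * mean b (\<lambda>i. (u i)\<^sup>2))"
    by (intro add_mono mult_left_mono mean_sum_list_square) auto
  also have "\<dots> = 2 * real h * (\<Sum>i\<in>I. (u i)\<^sup>2 * \<rho> i)"
    by (simp add: mean_eq_sum[OF finite_I supp_a] mean_eq_sum[OF finite_I supp_b] \<rho>_def
        sum.distrib algebra_simps sum_distrib_left)
  finally show ?thesis .
qed

text \<open>The case of \<open>lin_variance\<close> in which the functional is the indicator of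
  \<open>i\<close>.\<close>

lemma cdiff_variance:
  assumes "i \<in> I"
  shows "mean (batch h a b) (\<lambda>z. (cdiff z i - real h * \<delta> i)\<^sup>2) \<le> 2 * real h * \<rho> i"
proof -
  let ?u = "\<lambda>j. of_bool (j = i) :: real"
  have s: "(\<Sum>j\<in>I. ?u j * f j) = f i" for f
    using assms finite_I by (subst sum.remove[of _ i]) auto
  have "mean (batch h a b) (\<lambda>z. (cdiff z i - real h * \<delta> i)\<^sup>2) =
    mean (batch h a b) (\<lambda>z. (lin ?u z - real h * (\<Sum>j\<in>I. ?u j * \<delta> j))\<^sup>2)"
    by (intro mean_cong) (simp add: lin_eq s)
  also have "\<dots> \<le> 2 * real h * (\<Sum>j\<in>I. (?u j)\<^sup>2 * \<rho> j)" by (rule lin_variance)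
  also have "(\<Sum>j\<in>I. (?u j)\<^sup>2 * \<rho> j) = (\<Sum>j\<in>I. ?u j * \<rho> j)" by (intro sum.cong) auto
  finally show ?thesis by (simp add: s)
qed

lemma cdiff_second_moment:
  assumes "i \<in> I"
  shows "mean (batch h a b) (\<lambda>z. (cdiff z i)\<^sup>2) \<le> 2 * (real h)\<^sup>2 * (\<delta> i)\<^sup>2 + 4 * real h * \<rho> i"
proof -
  have "mean (batch h a b) (\<lambda>z. (cdiff z i)\<^sup>2) \<le>
    mean (batch h a b) (\<lambda>z. 2 * (cdiff z i - real h * \<delta> i)\<^sup>2 + 2 * (real h * \<delta> i)\<^sup>2)"
  proof (intro mean_mono)
    fix z
    show "(cdiff z i)\<^sup>2 \<le> 2 * (cdiff z i - real h * \<delta> i)\<^sup>2 + 2 * (real h * \<delta> i)\<^sup>2"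
      using square_add_le[of "cdiff z i - real h * \<delta> i" "real h * \<delta> i"] by simp
  qed simp
  also have "\<dots> = 2 * mean (batch h a b) (\<lambda>z. (cdiff z i - real h * \<delta> i)\<^sup>2) + 2 * (real h * \<delta> i)\<^sup>2"
    by (simp add: mean_add)
  also have "\<dots> \<le> 2 * (2 * real h * \<rho> i) + 2 * (real h * \<delta> i)\<^sup>2"
    using cdiff_variance[OF assms, of h] by simp
  finally show ?thesis by (simp add: power_mult_distrib algebra_simps)
qed

text \<open>Controls the sketching error, which for fixed batches is bounded by the product of their
  two weighted squared norms. The term \<open>8 * real h\<close> arises from
  \<open>w i \<le> 1\<close> and the total mass 2 of \<open>\<rho>\<close>.\<close>

lemma weighted_norm_mean:
  assumes "\<And>i. 0 \<le> w i" "\<And>i. w i \<le> 1"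
  shows "mean (batch h a b) (\<lambda>z. \<Sum>i\<in>I. w i * (cdiff z i)\<^sup>2) \<le> 2 * (real h)\<^sup>2 * (\<Sum>i\<in>I. w i * (\<delta> i)\<^sup>2) + 8 * real h"
proof -
  have "mean (batch h a b) (\<lambda>z. \<Sum>i\<in>I. w i * (cdiff z i)\<^sup>2) =
     (\<Sum>i\<in>I. w i * mean (batch h a b) (\<lambda>z. (cdiff z i)\<^sup>2))"
    by (simp add: mean_sum)
  also have "\<dots> \<le> (\<Sum>i\<in>I. w i * (2 * (real h)\<^sup>2 * (\<delta> i)\<^sup>2 + 4 * real h * \<rho> i))"
    using assms by (intro sum_mono mult_left_mono cdiff_second_moment) auto
  also have "\<dots> = 2 * (real h)\<^sup>2 * (\<Sum>i\<in>I. w i * (\<delta> i)\<^sup>2) + 4 * real h * (\<Sum>i\<in>I. w i * \<rho> i)"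
    by (simp add: sum.distrib sum_distrib_left algebra_simps)
  also have "\<dots> \<le> 2 * (real h)\<^sup>2 * (\<Sum>i\<in>I. w i * (\<delta> i)\<^sup>2) + 4 * real h * (\<Sum>i\<in>I. \<rho> i)"
    using assms rho_nonneg
    by (intro add_left_mono mult_left_mono sum_mono) (simp_all add: mult_left_le_one_le)
  finally show ?thesis by (simp add: sum_rho)
qed

text \<open>Expanding around the means leaves noise times noise and two terms of noise times signal.
  For fixed \<open>z\<close> the first is a centred linear functional of \<open>z'\<close> with
  coefficients \<open>e z\<close>, so \<open>lin_variance\<close> handles \<open>z'\<close> and then
  \<open>cdiff_variance\<close> handles \<open>z\<close>. The other two are linear functionals of a
  single batch with coefficients \<open>d\<close>.\<close>

lemma inner_product_variance:
  fixes w :: "'a \<Rightarrow> real"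
  defines "q \<equiv> \<Sum>i\<in>I. w i * (\<delta> i)\<^sup>2"
  shows "mean (batch h a b) (\<lambda>z. mean (batch h a b)
      (\<lambda>z'. ((\<Sum>i\<in>I. w i * cdiff z i * cdiff z' i) - (real h)\<^sup>2 * q)\<^sup>2)) \<le>
    12 * (real h)\<^sup>2 * (\<Sum>i\<in>I. (w i * \<rho> i)\<^sup>2) + 12 * real h ^ 3 * (\<Sum>i\<in>I. (w i * \<delta> i)\<^sup>2 * \<rho> i)"
proof -
  define D where "D = (\<lambda>u z. lin u z - real h * (\<Sum>i\<in>I. u i * \<delta> i))"
  define e where "e = (\<lambda>z i. w i * (cdiff z i - real h * \<delta> i))"
  define d where "d = (\<lambda>i. w i * \<delta> i)"
  define A where "A = (\<Sum>i\<in>I. (w i * \<rho> i)\<^sup>2)"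
  define B where "B = (\<Sum>i\<in>I. (w i * \<delta> i)\<^sup>2 * \<rho> i)"
  let ?P = "batch h a b"
  have decomp: "(\<Sum>i\<in>I. w i * cdiff z i * cdiff z' i) - (real h)\<^sup>2 * q = D (e z) z' + real h * D d z + real h * D d z'"
    if "z \<in> set_pmf ?P" "z' \<in> set_pmf ?P" for z z'
    unfolding D_def d_def e_def q_def lin_eq[OF that(1)] lin_eq[OF that(2)] sum_distrib_left
      sum_subtractf[symmetric] sum.distrib[symmetric]
    by (intro sum.cong) (auto simp: algebra_simps power2_eq_square)
  have Dd: "mean ?P (\<lambda>z. (D d z)\<^sup>2) \<le> 2 * real h * B"
    using lin_variance[of h d] by (simp add: D_def B_def d_def)
  have De: "mean ?P (\<lambda>z'. (D (e z) z')\<^sup>2) \<le> 2 * real h * (\<Sum>i\<in>I. (e z i)\<^sup>2 * \<rho> i)" for z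
    using lin_variance[of h "e z"] by (simp add: D_def)
  have "mean ?P (\<lambda>z. mean ?P (\<lambda>z'. ((\<Sum>i\<in>I. w i * cdiff z i * cdiff z' i) - (real h)\<^sup>2 * q)\<^sup>2)) \<le>
    mean ?P (\<lambda>z. mean ?P (\<lambda>z'. 3 * (D (e z) z')\<^sup>2 + (3 * (real h)\<^sup>2 * (D d z)\<^sup>2 + 3 * (real h)\<^sup>2 * (D d z')\<^sup>2)))"
  proof (intro mean_mono finite_batch)
    fix z z' assume "z \<in> set_pmf ?P" "z' \<in> set_pmf ?P"
    then show "((\<Sum>i\<in>I. w i * cdiff z i * cdiff z' i) - (real h)\<^sup>2 * q)\<^sup>2 \<le>
       3 * (D (e z) z')\<^sup>2 + (3 * (real h)\<^sup>2 * (D d z)\<^sup>2 + 3 * (real h)\<^sup>2 * (D d z')\<^sup>2)"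
      using square_add3_le[of "D (e z) z'" "real h * D d z" "real h * D d z'"]
      by (simp add: decomp power_mult_distrib)
  qed
  also have "\<dots> = mean ?P (\<lambda>z. 3 * mean ?P (\<lambda>z'. (D (e z) z')\<^sup>2) +
      (3 * (real h)\<^sup>2 * (D d z)\<^sup>2 + 3 * (real h)\<^sup>2 * mean ?P (\<lambda>z'. (D d z')\<^sup>2)))"
    by (simp add: mean_add)
  also have "\<dots> \<le> mean ?P (\<lambda>z. 3 * (2 * real h * (\<Sum>i\<in>I. (e z i)\<^sup>2 * \<rho> i)) +
      (3 * (real h)\<^sup>2 * (D d z)\<^sup>2 + 3 * (real h)\<^sup>2 * (2 * real h * B)))"
    by (intro mean_mono finite_batch add_mono mult_left_mono De Dd order_refl) auto
  also have "\<dots> = 3 * (2 * real h * (\<Sum>i\<in>I. mean ?P (\<lambda>z. (e z i)\<^sup>2) * \<rho> i)) +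
      (3 * (real h)\<^sup>2 * mean ?P (\<lambda>z. (D d z)\<^sup>2) + 3 * (real h)\<^sup>2 * (2 * real h * B))"
    by (simp add: mean_add mean_sum)
  also have "\<dots> \<le> 3 * (2 * real h * (2 * real h * A)) + (3 * (real h)\<^sup>2 * (2 * real h * B) + 3 * (real h)\<^sup>2 * (2 * real h * B))"
  proof -
    have "(\<Sum>i\<in>I. mean ?P (\<lambda>z. (e z i)\<^sup>2) * \<rho> i) \<le> (\<Sum>i\<in>I. 2 * real h * (w i * \<rho> i)\<^sup>2)"
    proof (rule sum_mono)
      fix i assume i: "i \<in> I"
      have "mean ?P (\<lambda>z. (e z i)\<^sup>2) * \<rho> i =
        (w i)\<^sup>2 * \<rho> i * mean ?P (\<lambda>z. (cdiff z i - real h * \<delta> i)\<^sup>2)"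
        by (simp add: e_def power_mult_distrib)
      also have "\<dots> \<le> (w i)\<^sup>2 * \<rho> i * (2 * real h * \<rho> i)"
        by (intro mult_left_mono cdiff_variance[OF i]) (simp add: rho_nonneg)
      finally show "mean ?P (\<lambda>z. (e z i)\<^sup>2) * \<rho> i \<le> 2 * real h * (w i * \<rho> i)\<^sup>2"
        by (simp add: power2_eq_square algebra_simps)
    qed
    then have "(\<Sum>i\<in>I. mean ?P (\<lambda>z. (e z i)\<^sup>2) * \<rho> i) \<le> 2 * real h * A"
      by (simp add: A_def sum_distrib_left)
    then show ?thesis
      by (intro add_mono mult_left_mono Dd order_refl) auto
  qed
  finally show ?thesis
    by (simp add: A_def B_def power2_eq_square power3_eq_cube algebra_simps)
qed

text \<open>For fixed batches the \<open>m\<close> products are independent with the weighted inner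
  product as their common mean. Their second moment expands into fourfold products of signs, which
  \<open>quads\<close> evaluates and \<open>quadruple_sum_le\<close> bounds.\<close>

lemma sketch_variance:
  fixes S :: "'s pmf" and \<sigma> :: "'s \<Rightarrow> 'a \<Rightarrow> real" and g :: "'a \<Rightarrow> real"
  assumes fin_S: "finite (set_pmf S)"
    and pairs: "\<And>i j. i \<in> I \<Longrightarrow> j \<in> I \<Longrightarrow> mean S (\<lambda>s. \<sigma> s i * \<sigma> s j) = of_bool (i = j)"
    and quads: "\<And>i j k l. i \<in> I \<Longrightarrow> j \<in> I \<Longrightarrow> k \<in> I \<Longrightarrow> l \<in> I \<Longrightarrow>
       mean S (\<lambda>s. \<sigma> s i * \<sigma> s j * (\<sigma> s k * \<sigma> s l)) =
       of_bool ((i = j \<and> k = l) \<or> (i = k \<and> j = l) \<or> (i = l \<and> j = k))"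
    and z: "z \<in> set_pmf (batch h a b)" and z': "z' \<in> set_pmf (batch h a b)"
  shows "mean (replicate_pmf m S) (\<lambda>ss. (sketch_stat (\<lambda>s i. \<sigma> s i * g i) ss z z'
       - real m * (\<Sum>i\<in>I. (g i)\<^sup>2 * cdiff z i * cdiff z' i))\<^sup>2) \<le>
    3 * real m * ((\<Sum>i\<in>I. (g i)\<^sup>2 * (cdiff z i)\<^sup>2) * (\<Sum>i\<in>I. (g i)\<^sup>2 * (cdiff z' i)\<^sup>2))"
proof -
  define u v where "u = (\<lambda>i. g i * cdiff z i)" and "v = (\<lambda>i. g i * cdiff z' i)"
  define f where "f = (\<lambda>s. lin (\<lambda>i. \<sigma> s i * g i) z * lin (\<lambda>i. \<sigma> s i * g i) z')"
  have lin_u: "lin (\<lambda>i. \<sigma> s i * g i) z = (\<Sum>i\<in>I. u i * \<sigma> s i)" for s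
    by (simp add: lin_eq[OF z] u_def algebra_simps)
  have lin_v: "lin (\<lambda>i. \<sigma> s i * g i) z' = (\<Sum>i\<in>I. v i * \<sigma> s i)" for s
    by (simp add: lin_eq[OF z'] v_def algebra_simps)
  have "mean S f = (\<Sum>i\<in>I. \<Sum>j\<in>I. u i * v j * mean S (\<lambda>s. \<sigma> s i * \<sigma> s j))"
  proof -
    have "f s = (\<Sum>i\<in>I. \<Sum>j\<in>I. u i * v j * (\<sigma> s i * \<sigma> s j))" for s
      unfolding f_def lin_u lin_v sum_product by (simp add: mult_ac)
    then have "f = (\<lambda>s. \<Sum>i\<in>I. \<Sum>j\<in>I. u i * v j * (\<sigma> s i * \<sigma> s j))" by (rule ext)
    then show ?thesis by (simp add: mean_sum[OF fin_S])
  qed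
  also have "\<dots> = (\<Sum>i\<in>I. \<Sum>j\<in>I. u i * v j * of_bool (i = j))"
    by (simp add: pairs)
  also have "\<dots> = (\<Sum>i\<in>I. (g i)\<^sup>2 * cdiff z i * cdiff z' i)"
  proof (rule sum.cong[OF refl])
    fix i assume "i \<in> I"
    then show "(\<Sum>j\<in>I. u i * v j * of_bool (i = j)) = (g i)\<^sup>2 * cdiff z i * cdiff z' i"
      using finite_I by (subst sum.remove[of _ i])
        (auto simp: u_def v_def power2_eq_square mult_ac intro!: sum.neutral)
  qed
  finally have mean_f: "mean S f = (\<Sum>i\<in>I. (g i)\<^sup>2 * cdiff z i * cdiff z' i)" .
  have "mean S (\<lambda>s. (f s)\<^sup>2) = (\<Sum>i\<in>I. \<Sum>j\<in>I. \<Sum>k\<in>I. \<Sum>l\<in>I. u i * u j * (v k * v l) *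
      mean S (\<lambda>s. \<sigma> s i * \<sigma> s j * (\<sigma> s k * \<sigma> s l)))"
  proof -
    have "(f s)\<^sup>2 = (\<Sum>i\<in>I. \<Sum>j\<in>I. \<Sum>k\<in>I. \<Sum>l\<in>I. u i * u j * (v k * v l) *
        (\<sigma> s i * \<sigma> s j * (\<sigma> s k * \<sigma> s l)))" for s
    proof -
      have "(f s)\<^sup>2 = ((\<Sum>i\<in>I. u i * \<sigma> s i) * (\<Sum>i\<in>I. u i * \<sigma> s i)) *
          ((\<Sum>i\<in>I. v i * \<sigma> s i) * (\<Sum>i\<in>I. v i * \<sigma> s i))"
        unfolding f_def lin_u lin_v by (simp add: power2_eq_square mult_ac)
      also have "\<dots> = (\<Sum>i\<in>I. \<Sum>j\<in>I. u i * \<sigma> s i * (u j * \<sigma> s j)) *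
          (\<Sum>k\<in>I. \<Sum>l\<in>I. v k * \<sigma> s k * (v l * \<sigma> s l))"
        unfolding sum_product ..
      also have "\<dots> = (\<Sum>i\<in>I. \<Sum>j\<in>I. \<Sum>k\<in>I. \<Sum>l\<in>I. u i * \<sigma> s i * (u j * \<sigma> s j) *
          (v k * \<sigma> s k * (v l * \<sigma> s l)))"
        by (simp only: sum_distrib_right) (simp only: sum_distrib_left)
      finally show ?thesis by (simp add: mult_ac)
    qed
    then show ?thesis by (simp add: mean_sum[OF fin_S])
  qed
  also have "\<dots> = (\<Sum>i\<in>I. \<Sum>j\<in>I. \<Sum>k\<in>I. \<Sum>l\<in>I. u i * u j * (v k * v l) *
      of_bool ((i = j \<and> k = l) \<or> (i = k \<and> j = l) \<or> (i = l \<and> j = k)))"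
    by (intro sum.cong refl) (simp only: quads)
  also have "\<dots> \<le> 3 * ((\<Sum>i\<in>I. (u i)\<^sup>2) * (\<Sum>i\<in>I. (v i)\<^sup>2))"
    by (rule quadruple_sum_le[OF finite_I])
  finally have mean_f2: "mean S (\<lambda>s. (f s)\<^sup>2) \<le>
     3 * ((\<Sum>i\<in>I. (g i)\<^sup>2 * (cdiff z i)\<^sup>2) * (\<Sum>i\<in>I. (g i)\<^sup>2 * (cdiff z' i)\<^sup>2))"
    by (simp add: u_def v_def power_mult_distrib)
  have "mean (replicate_pmf m S) (\<lambda>ss. (sketch_stat (\<lambda>s i. \<sigma> s i * g i) ss z z'
       - real m * (\<Sum>i\<in>I. (g i)\<^sup>2 * cdiff z i * cdiff z' i))\<^sup>2) \<le> real m * mean S (\<lambda>s. (f s)\<^sup>2)"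
    using mean_sum_list_square[OF fin_S, of m f] unfolding sketch_stat_def f_def[symmetric] mean_f .
  also have "\<dots> \<le> real m * (3 * ((\<Sum>i\<in>I. (g i)\<^sup>2 * (cdiff z i)\<^sup>2) * (\<Sum>i\<in>I. (g i)\<^sup>2 * (cdiff z' i)\<^sup>2)))"
    by (rule mult_left_mono[OF mean_f2]) simp
  finally show ?thesis by (simp add: mult_ac)
qed

text \<open>The deviation is split into the sketching error for fixed batches and \<open>m\<close>
  times the sampling error of the inner product. The product \<open>N z * N z'\<close> factors in
  the mean because the two batches are independent.\<close>

lemma sketch_stat_variance:
  fixes S :: "'s pmf" and \<sigma> :: "'s \<Rightarrow> 'a \<Rightarrow> real" and g :: "'a \<Rightarrow> real" and h m :: nat
  assumes fin_S: "finite (set_pmf S)"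
    and pairs: "\<And>i j. i \<in> I \<Longrightarrow> j \<in> I \<Longrightarrow> mean S (\<lambda>s. \<sigma> s i * \<sigma> s j) = of_bool (i = j)"
    and quads: "\<And>i j k l. i \<in> I \<Longrightarrow> j \<in> I \<Longrightarrow> k \<in> I \<Longrightarrow> l \<in> I \<Longrightarrow>
       mean S (\<lambda>s. \<sigma> s i * \<sigma> s j * (\<sigma> s k * \<sigma> s l)) =
       of_bool ((i = j \<and> k = l) \<or> (i = k \<and> j = l) \<or> (i = l \<and> j = k))"
    and g: "\<And>i. (g i)\<^sup>2 \<le> 1"
  defines "q \<equiv> \<Sum>i\<in>I. (g i)\<^sup>2 * (\<delta> i)\<^sup>2"
  shows "mean (batch h a b) (\<lambda>z. mean (batch h a b) (\<lambda>z'. mean (replicate_pmf m S)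
      (\<lambda>ss. (sketch_stat (\<lambda>s i. \<sigma> s i * g i) ss z z' - real m * ((real h)\<^sup>2 * q))\<^sup>2))) \<le>
    6 * real m * (2 * (real h)\<^sup>2 * q + 8 * real h)\<^sup>2 +
    2 * (real m)\<^sup>2 * (12 * (real h)\<^sup>2 * (\<Sum>i\<in>I. ((g i)\<^sup>2 * \<rho> i)\<^sup>2) + 12 * real h ^ 3 * (\<Sum>i\<in>I. ((g i)\<^sup>2 * \<delta> i)\<^sup>2 * \<rho> i))"
proof -
  let ?P = "batch h a b"
  let ?R = "replicate_pmf m S"
  define T where "T = (\<lambda>z z'. \<Sum>i\<in>I. (g i)\<^sup>2 * cdiff z i * cdiff z' i)"
  define N where "N = (\<lambda>z. \<Sum>i\<in>I. (g i)\<^sup>2 * (cdiff z i)\<^sup>2)"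
  define V where "V = 12 * (real h)\<^sup>2 * (\<Sum>i\<in>I. ((g i)\<^sup>2 * \<rho> i)\<^sup>2) + 12 * real h ^ 3 * (\<Sum>i\<in>I. ((g i)\<^sup>2 * \<delta> i)\<^sup>2 * \<rho> i)"
  have fin_R: "finite (set_pmf ?R)" using fin_S by simp
  have N_nonneg: "0 \<le> N z" for z by (simp add: N_def sum_nonneg)
  have mean_N: "mean ?P N \<le> 2 * (real h)\<^sup>2 * q + 8 * real h"
    unfolding N_def q_def using g by (intro weighted_norm_mean) auto
  have mean_N_nonneg: "0 \<le> mean ?P N" by (intro integral_nonneg_AE) (simp add: N_nonneg)
  have inner: "mean ?R (\<lambda>ss. (sketch_stat (\<lambda>s i. \<sigma> s i * g i) ss z z' - real m * ((real h)\<^sup>2 * q))\<^sup>2) \<le>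
      6 * real m * (N z * N z') + 2 * (real m)\<^sup>2 * (T z z' - (real h)\<^sup>2 * q)\<^sup>2"
    if zz: "z \<in> set_pmf ?P" "z' \<in> set_pmf ?P" for z z'
  proof -
    let ?f = "\<lambda>ss. sketch_stat (\<lambda>s i. \<sigma> s i * g i) ss z z'"
    have "mean ?R (\<lambda>ss. (?f ss - real m * ((real h)\<^sup>2 * q))\<^sup>2) \<le>
      mean ?R (\<lambda>ss. 2 * (?f ss - real m * T z z')\<^sup>2 + 2 * (real m * (T z z' - (real h)\<^sup>2 * q))\<^sup>2)"
    proof (intro mean_mono fin_R)
      fix ss
      show "(?f ss - real m * ((real h)\<^sup>2 * q))\<^sup>2 \<le> 2 * (?f ss - real m * T z z')\<^sup>2 + 2 * (real m * (T z z' - (real h)\<^sup>2 * q))\<^sup>2"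
        using square_add_le[of "?f ss - real m * T z z'" "real m * (T z z' - (real h)\<^sup>2 * q)"] by (simp add: algebra_simps)
    qed
    also have "\<dots> = 2 * mean ?R (\<lambda>ss. (?f ss - real m * T z z')\<^sup>2) + 2 * (real m * (T z z' - (real h)\<^sup>2 * q))\<^sup>2"
      by (simp add: mean_add[OF fin_R])
    also have "\<dots> \<le> 2 * (3 * real m * (N z * N z')) + 2 * (real m * (T z z' - (real h)\<^sup>2 * q))\<^sup>2"
      unfolding T_def N_def
      by (intro add_mono mult_left_mono sketch_variance[OF fin_S pairs quads zz] order_refl) auto
    finally show ?thesis by (simp add: power_mult_distrib)
  qed
  have "mean ?P (\<lambda>z. mean ?P (\<lambda>z'. mean ?R
      (\<lambda>ss. (sketch_stat (\<lambda>s i. \<sigma> s i * g i) ss z z' - real m * ((real h)\<^sup>2 * q))\<^sup>2))) \<le>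
    mean ?P (\<lambda>z. mean ?P (\<lambda>z'. 6 * real m * (N z * N z') + 2 * (real m)\<^sup>2 * (T z z' - (real h)\<^sup>2 * q)\<^sup>2))"
    by (intro mean_mono finite_batch inner)
  also have "\<dots> = 6 * real m * (mean ?P N * mean ?P N) +
      2 * (real m)\<^sup>2 * mean ?P (\<lambda>z. mean ?P (\<lambda>z'. (T z z' - (real h)\<^sup>2 * q)\<^sup>2))"
    by (simp add: mean_add)
  also have "\<dots> \<le> 6 * real m * ((2 * (real h)\<^sup>2 * q + 8 * real h) * (2 * (real h)\<^sup>2 * q + 8 * real h)) + 2 * (real m)\<^sup>2 * V"
    unfolding V_def T_def q_def
    using mean_N mean_N_nonneg unfolding q_def
    by (intro add_mono mult_left_mono mult_mono inner_product_variance) auto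
  finally show ?thesis by (simp add: V_def power2_eq_square)
qed

end

section \<open>Flattening weights\<close>

text \<open>The integer part of the logarithm of \<open>1 + c\<close> to base 4.\<close>

definition lev :: "nat \<Rightarrow> nat" where
  "lev c = (LEAST r. 1 + c < 4 ^ Suc r)"

lemma lev_upper: "1 + c < 4 ^ Suc (lev c)"
  unfolding lev_def
proof (rule LeastI)
  have "c < 4 ^ c" by (induction c) auto
  then show "1 + c < 4 ^ Suc c" by simp
qed

lemma lev_lower: "4 ^ lev c \<le> 1 + c"
proof (cases "lev c")
  case (Suc r)
  then have "\<not> 1 + c < 4 ^ Suc r" unfolding lev_def by (intro not_less_Least) simp
  with Suc show ?thesis by simp
qed simp

lemma lev_mono: "c \<le> d \<Longrightarrow> lev c \<le> lev d"
  using lev_upper[of d] unfolding lev_def[of c] by (intro Least_le) simp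

text \<open>The square of this weight is \<open>1 / (1 + c)\<close> rounded up to a power of \<open>4\<close>, so that the sketches
  are dyadic rationals with a bounded denominator and can be sent exactly.\<close>

definition flat_wt :: "'a list \<times> 'a list \<Rightarrow> 'a \<Rightarrow> real" where
  "flat_wt f i = 1 / 2 ^ lev (count_list (fst f) i + count_list (snd f) i)"

lemma flat_square: "(flat_wt f i)\<^sup>2 = 1 / 4 ^ lev (count_list (fst f) i + count_list (snd f) i)"
  by (simp add: flat_wt_def power_divide power_mult[symmetric] mult.commute[of _ 2]) (simp add: power_mult)

lemma flat_square_le_1: "(flat_wt f i)\<^sup>2 \<le> 1"
  by (simp add: flat_square)

lemma flat_square_le: "(flat_wt f i)\<^sup>2 \<le> 4 / (1 + real (count_list (fst f) i + count_list (snd f) i))"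
proof -
  let ?c = "count_list (fst f) i + count_list (snd f) i"
  have "real (1 + ?c) < real (4 ^ Suc (lev ?c))" using lev_upper[of ?c] by (simp only: of_nat_less_iff)
  then show ?thesis unfolding flat_square by (simp add: field_simps)
qed

lemma flat_square_ge: "1 / (1 + real (count_list (fst f) i + count_list (snd f) i)) \<le> (flat_wt f i)\<^sup>2"
proof -
  let ?c = "count_list (fst f) i + count_list (snd f) i"
  have "real (4 ^ lev ?c) \<le> real (1 + ?c)" using lev_lower[of ?c] by (simp only: of_nat_le_iff)
  then show ?thesis unfolding flat_square by (simp add: field_simps)
qed

section \<open>Effect of flattening on the mass and on the distance\<close>

context two_sources
begin

text \<open>One of the two factors \<open>(flat_wt f i)\<^sup>2\<close> is bounded by 1. The other
  is bounded through Alice's count alone where it multiplies \<open>(pmf a i)\<^sup>2\<close> and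
  through Bob's alone where it multiplies \<open>(pmf b i)\<^sup>2\<close>, so that
  \<open>mean_inverse_count\<close> trades one factor of the mass for
  \<open>1 / (k + 1)\<close>.\<close>

lemma mean_flat_rho_le:
  "mean (batch k a b) (\<lambda>f. \<Sum>i\<in>I. ((flat_wt f i)\<^sup>2 * \<rho> i)\<^sup>2) \<le> 16 / (real k + 1)"
proof -
  let ?A = "\<lambda>xs (i :: 'a). 1 / (1 + real (count_list xs i))"
  have "mean (batch k a b) (\<lambda>f. \<Sum>i\<in>I. ((flat_wt f i)\<^sup>2 * \<rho> i)\<^sup>2) \<le>
    mean (batch k a b) (\<lambda>f. \<Sum>i\<in>I. 8 * (pmf a i)\<^sup>2 * ?A (fst f) i + 8 * (pmf b i)\<^sup>2 * ?A (snd f) i)"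
  proof (intro mean_mono finite_batch sum_mono)
    fix f :: "'a list \<times> 'a list" and i :: 'a
    let ?w = "(flat_wt f i)\<^sup>2"
    have wA: "?w \<le> 4 * ?A (fst f) i" and wB: "?w \<le> 4 * ?A (snd f) i"
      by (rule order_trans[OF flat_square_le]; simp add: field_simps)+
    have "(?w * \<rho> i)\<^sup>2 = ?w * (?w * (\<rho> i)\<^sup>2)" by (simp add: power2_eq_square mult_ac)
    also have "\<dots> \<le> 1 * (?w * (\<rho> i)\<^sup>2)" by (intro mult_right_mono flat_square_le_1) auto
    also have "\<dots> \<le> ?w * (2 * (pmf a i)\<^sup>2 + 2 * (pmf b i)\<^sup>2)"
      unfolding \<rho>_def by (simp add: mult_left_mono[OF square_add_le])
    also have "\<dots> = ?w * (2 * (pmf a i)\<^sup>2) + ?w * (2 * (pmf b i)\<^sup>2)"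
      by (simp add: algebra_simps)
    also have "\<dots> \<le> (4 * ?A (fst f) i) * (2 * (pmf a i)\<^sup>2) + (4 * ?A (snd f) i) * (2 * (pmf b i)\<^sup>2)"
      by (intro add_mono mult_right_mono wA wB) auto
    finally show "(?w * \<rho> i)\<^sup>2 \<le> 8 * (pmf a i)\<^sup>2 * ?A (fst f) i + 8 * (pmf b i)\<^sup>2 * ?A (snd f) i"
      by (simp add: mult_ac)
  qed
  also have "\<dots> = (\<Sum>i\<in>I. 8 * pmf a i * (pmf a i * mean (replicate_pmf k a) (\<lambda>xs. ?A xs i))
      + 8 * pmf b i * (pmf b i * mean (replicate_pmf k b) (\<lambda>xs. ?A xs i)))"
  proof -
    have "mean (batch k a b) (\<lambda>f. c * F (fst f)) = c * mean (replicate_pmf k a) F"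
      "mean (batch k a b) (\<lambda>f. c * F (snd f)) = c * mean (replicate_pmf k b) F" for c F
      unfolding batch_def by (simp_all add: mean_pair)
    note m = this[where F="\<lambda>xs. ?A xs i" for i]
    show ?thesis
      by (simp only: mean_sum mean_add finite_batch m) (simp add: power2_eq_square mult_ac)
  qed
  also have "\<dots> \<le> (\<Sum>i\<in>I. 8 * pmf a i * (1 / (real k + 1)) + 8 * pmf b i * (1 / (real k + 1)))"
    using mean_inverse_count[of k a] mean_inverse_count[of k b]
    by (intro sum_mono add_mono mult_left_mono) (simp_all add: field_simps)
  also have "\<dots> = 8 / (real k + 1) * (\<Sum>i\<in>I. \<rho> i)"
    by (simp add: \<rho>_def sum_distrib_left sum_divide_distrib add_divide_distrib algebra_simps)
  finally show ?thesis by (simp add: sum_rho)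
qed

text \<open>Cauchy-Schwarz for \<open>\<bar>\<delta> i\<bar> = (w * \<bar>\<delta> i\<bar>) * (1 /
  w)\<close> with \<open>w = flat_wt f i\<close>: here \<open>1 / w\<^sup>2\<close> is at most one
  plus the count of \<open>i\<close>, and all counts add up to \<open>2 * k\<close>. The bound holds
  for every outcome of the flattening batch.\<close>

lemma flat_l2_ge:
  assumes "f \<in> set_pmf (batch k a b)"
  shows "(\<Sum>i\<in>I. \<bar>\<delta> i\<bar>)\<^sup>2 \<le> (\<Sum>i\<in>I. (flat_wt f i)\<^sup>2 * (\<delta> i)\<^sup>2) * (card I + 2 * real k)"
proof -
  have pos: "0 < flat_wt f i" for i by (simp add: flat_wt_def)
  have len: "length (fst f) = k" "length (snd f) = k"
    using assms by (auto simp: batch_def set_replicate_pmf)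
  have cnt: "(\<Sum>i\<in>I. real (count_list xs i)) = length xs" if "set xs \<subseteq> I" for xs
    using sum_list_map_eq_sum_count_real[OF finite_I that, of "\<lambda>_. 1"] by (simp add: sum_list_triv)
  have "(\<Sum>i\<in>I. \<bar>\<delta> i\<bar>)\<^sup>2 = (\<Sum>i\<in>I. (flat_wt f i * \<bar>\<delta> i\<bar>) * (1 / flat_wt f i))\<^sup>2"
    using pos by (intro arg_cong[where f="\<lambda>x. x\<^sup>2"] sum.cong) (auto simp: less_imp_neq[THEN not_sym])
  also have "\<dots> \<le> (\<Sum>i\<in>I. (flat_wt f i * \<bar>\<delta> i\<bar>)\<^sup>2) * (\<Sum>i\<in>I. (1 / flat_wt f i)\<^sup>2)"
    by (rule Cauchy_Schwarz_ineq_sum)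
  also have "\<dots> \<le> (\<Sum>i\<in>I. (flat_wt f i * \<bar>\<delta> i\<bar>)\<^sup>2) *
      (\<Sum>i\<in>I. 1 + real (count_list (fst f) i) + real (count_list (snd f) i))"
  proof (intro mult_left_mono sum_mono sum_nonneg zero_le_power2)
    fix i
    show "(1 / flat_wt f i)\<^sup>2 \<le> 1 + real (count_list (fst f) i) + real (count_list (snd f) i)"
      using flat_square_ge[of f i] pos[of i] by (simp add: power_divide field_simps)
  qed
  also have "(\<Sum>i\<in>I. 1 + real (count_list (fst f) i) + real (count_list (snd f) i)) = card I + 2 * real k"
    using cnt batch_supp[OF assms] by (simp add: sum.distrib len)
  finally show ?thesis by (simp add: power_mult_distrib)
qed

text \<open>Chebyshev's inequality for fixed weights. \<open>W\<close> stands for the event of a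
  wrong answer; the deviation \<open>max q \<tau> / 2\<close> serves both the case of equal
  distributions, where \<open>q = 0\<close>, and the far case, where
  \<open>q \<ge> \<tau>\<close>.\<close>

lemma batch_test_error:
  fixes S :: "'s pmf" and \<sigma> :: "'s \<Rightarrow> 'a \<Rightarrow> real" and g :: "'a \<Rightarrow> real" and h m :: nat and \<tau> :: real
  assumes fin_S: "finite (set_pmf S)"
    and pairs: "\<And>i j. i \<in> I \<Longrightarrow> j \<in> I \<Longrightarrow> mean S (\<lambda>s. \<sigma> s i * \<sigma> s j) = of_bool (i = j)"
    and quads: "\<And>i j k l. i \<in> I \<Longrightarrow> j \<in> I \<Longrightarrow> k \<in> I \<Longrightarrow> l \<in> I \<Longrightarrow>
       mean S (\<lambda>s. \<sigma> s i * \<sigma> s j * (\<sigma> s k * \<sigma> s l)) =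
       of_bool ((i = j \<and> k = l) \<or> (i = k \<and> j = l) \<or> (i = l \<and> j = k))"
    and g: "\<And>i. (g i)\<^sup>2 \<le> 1"
    and A: "(\<Sum>i\<in>I. ((g i)\<^sup>2 * \<rho> i)\<^sup>2) \<le> (real h * \<tau> / 1200)\<^sup>2"
    and m: "10000 \<le> m" "76800 \<le> real m * (real h * \<tau>)\<^sup>2"
    and \<tau>: "0 < \<tau>" and h: "0 < h"
  defines "q \<equiv> \<Sum>i\<in>I. (g i)\<^sup>2 * (\<delta> i)\<^sup>2"
  assumes W: "\<And>z z' ss. W z z' ss \<Longrightarrow>
      real m * (real h)\<^sup>2 * max q \<tau> / 2 \<le>
      \<bar>sketch_stat (\<lambda>s i. \<sigma> s i * g i) ss z z' - real m * ((real h)\<^sup>2 * q)\<bar>"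
  shows "mean (batch h a b) (\<lambda>z. mean (batch h a b) (\<lambda>z'. mean (replicate_pmf m S)
      (\<lambda>ss. of_bool (W z z' ss)))) \<le> 1 / 6"
proof -
  let ?P = "batch h a b"
  let ?R = "replicate_pmf m S"
  define A' where "A' = (\<Sum>i\<in>I. ((g i)\<^sup>2 * \<rho> i)\<^sup>2)"
  define B where "B = (\<Sum>i\<in>I. ((g i)\<^sup>2 * \<delta> i)\<^sup>2 * \<rho> i)"
  define Q where "Q = max q \<tau>"
  define X where "X = (\<lambda>z z' ss. (sketch_stat (\<lambda>s i. \<sigma> s i * g i) ss z z' - real m * ((real h)\<^sup>2 * q))\<^sup>2)"
  have fin_R: "finite (set_pmf ?R)" using fin_S by simp
  have q0: "0 \<le> q" by (simp add: q_def sum_nonneg)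
  have Q: "0 < Q" "q \<le> Q" "\<tau> \<le> Q" using \<tau> by (auto simp: Q_def)
  define D where "D = (real m * (real h)\<^sup>2 * Q / 2)\<^sup>2"
  have D: "0 < D" using m(1) h Q(1) by (simp add: D_def)
  have cheb: "of_bool (W z z' ss) \<le> X z z' ss / D" for z z' ss
  proof (cases "W z z' ss")
    case True
    have "D \<le> X z z' ss"
      unfolding D_def X_def
      using W[OF True] Q(1) by (intro abs_le_square_iff[THEN iffD1]) (simp add: Q_def)
    with True D show ?thesis by simp
  next
    case False
    then show ?thesis using D by (simp add: X_def)
  qed
  have "mean ?P (\<lambda>z. mean ?P (\<lambda>z'. mean ?R (\<lambda>ss. of_bool (W z z' ss)))) \<le>
    mean ?P (\<lambda>z. mean ?P (\<lambda>z'. mean ?R (\<lambda>ss. X z z' ss / D)))"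
    by (intro mean_mono finite_batch fin_R cheb)
  also have "\<dots> = mean ?P (\<lambda>z. mean ?P (\<lambda>z'. mean ?R (X z z'))) / D"
    by simp
  also have "\<dots> \<le> (6 * real m * (2 * (real h)\<^sup>2 * q + 8 * real h)\<^sup>2 +
      2 * (real m)\<^sup>2 * (12 * (real h)\<^sup>2 * A' + 12 * real h ^ 3 * B)) / D"
    using sketch_stat_variance[OF fin_S pairs quads g, of h m] D
    unfolding X_def A'_def B_def q_def by (intro divide_right_mono) auto
  also have "\<dots> \<le> (D / 6) / D"
  proof (intro divide_right_mono less_imp_le[OF D])
    \<comment> \<open>The constants are chosen so that \<open>48/10000 + 1/100 + 24/1440000 + 24/1200 < 1/24\<close>.\<close>
    define M H where "M = real m" and "H = real h"
    have M: "10000 \<le> M" and H: "0 < H" using m(1) h by (simp_all add: M_def H_def)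
    \<comment> \<open>Each \<open>(g i)\<^sup>2 * \<rho> i\<close> is at most the root of the sum of
      their squares, so one such factor can be pulled out of \<open>B\<close>, which leaves
      \<open>q\<close>.\<close>
    have B: "B \<le> H * \<tau> / 1200 * q"
    proof -
      have "(g i)\<^sup>2 * \<rho> i \<le> H * \<tau> / 1200" if "i \<in> I" for i
      proof (rule power2_le_imp_le)
        have "((g i)\<^sup>2 * \<rho> i)\<^sup>2 \<le> A'"
          unfolding A'_def using that finite_I by (intro member_le_sum) auto
        with A show "((g i)\<^sup>2 * \<rho> i)\<^sup>2 \<le> (H * \<tau> / 1200)\<^sup>2" by (simp add: A'_def H_def)
        show "0 \<le> H * \<tau> / 1200" using H \<tau> by simp
      qed
      then have "(\<Sum>i\<in>I. ((g i)\<^sup>2 * \<rho> i) * ((g i)\<^sup>2 * (\<delta> i)\<^sup>2)) \<le> (\<Sum>i\<in>I. H * \<tau> / 1200 * ((g i)\<^sup>2 * (\<delta> i)\<^sup>2))"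
        by (intro sum_mono mult_right_mono) auto
      then show ?thesis
        by (simp add: B_def q_def sum_distrib_left power2_eq_square mult_ac)
    qed
    \<comment> \<open>\<open>Y\<close> is \<open>4 * D\<close>; the four error terms below are all
      measured against it.\<close>
    define Y where "Y = M\<^sup>2 * H ^ 4 * Q\<^sup>2"
    have qQ: "q\<^sup>2 \<le> Q\<^sup>2" "\<tau>\<^sup>2 \<le> Q\<^sup>2" "\<tau> * q \<le> Q * Q"
      using q0 Q \<tau> by (auto intro!: power_mono mult_mono)
    have t1: "48 * (M * H ^ 4 * q\<^sup>2) \<le> 48 / 10000 * Y"
    proof -
      have "10000 * (M * H ^ 4 * q\<^sup>2) \<le> M * (M * H ^ 4 * q\<^sup>2)"
        using M by (intro mult_right_mono) auto
      also have "\<dots> = M\<^sup>2 * H ^ 4 * q\<^sup>2" by (simp add: power2_eq_square)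
      also have "\<dots> \<le> Y" unfolding Y_def using qQ by (intro mult_left_mono) auto
      finally show ?thesis by linarith
    qed
    have t2: "768 * (M * H\<^sup>2) \<le> Y / 100"
    proof -
      have "76800 * (M * H\<^sup>2) \<le> M * (H * \<tau>)\<^sup>2 * (M * H\<^sup>2)"
        using m(2) M H by (intro mult_right_mono) (auto simp: M_def H_def)
      also have "\<dots> = M\<^sup>2 * H ^ 4 * \<tau>\<^sup>2" by (simp add: power2_eq_square power4_eq_xxxx)
      also have "\<dots> \<le> Y" unfolding Y_def using qQ by (intro mult_left_mono) auto
      finally show ?thesis by linarith
    qed
    have t3: "M\<^sup>2 * H\<^sup>2 * A' \<le> Y / 1440000"
    proof -
      have "M\<^sup>2 * H\<^sup>2 * A' \<le> M\<^sup>2 * H\<^sup>2 * (H * \<tau> / 1200)\<^sup>2"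
        using A by (intro mult_left_mono) (auto simp: A'_def H_def)
      also have "\<dots> = M\<^sup>2 * H ^ 4 * \<tau>\<^sup>2 / 1440000" by (simp add: power2_eq_square power4_eq_xxxx)
      also have "\<dots> \<le> Y / 1440000" unfolding Y_def using qQ by (intro divide_right_mono mult_left_mono) auto
      finally show ?thesis .
    qed
    have t4: "M\<^sup>2 * H ^ 3 * B \<le> Y / 1200"
    proof -
      have "M\<^sup>2 * H ^ 3 * B \<le> M\<^sup>2 * H ^ 3 * (H * \<tau> / 1200 * q)"
        using B H by (intro mult_left_mono) auto
      also have "\<dots> = M\<^sup>2 * H ^ 4 * (\<tau> * q) / 1200" by (simp add: power3_eq_cube power4_eq_xxxx)
      also have "\<dots> \<le> Y / 1200"
        unfolding Y_def power2_eq_square[of Q] using qQ by (intro divide_right_mono mult_left_mono) auto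
      finally show ?thesis .
    qed
    have "6 * M * (2 * H\<^sup>2 * q + 8 * H)\<^sup>2 \<le> 6 * M * (2 * (2 * H\<^sup>2 * q)\<^sup>2 + 2 * (8 * H)\<^sup>2)"
      using M by (intro mult_left_mono square_add_le) auto
    also have "\<dots> = 48 * (M * H ^ 4 * q\<^sup>2) + 768 * (M * H\<^sup>2)"
      by (simp add: power2_eq_square power4_eq_xxxx algebra_simps)
    finally have "6 * M * (2 * H\<^sup>2 * q + 8 * H)\<^sup>2 + 2 * M\<^sup>2 * (12 * H\<^sup>2 * A' + 12 * H ^ 3 * B) \<le>
       48 * (M * H ^ 4 * q\<^sup>2) + 768 * (M * H\<^sup>2) + (24 * (M\<^sup>2 * H\<^sup>2 * A') + 24 * (M\<^sup>2 * H ^ 3 * B))"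
      by (simp add: algebra_simps)
    moreover have "0 \<le> Y" by (simp add: Y_def)
    moreover have "D / 6 = Y / 24"
      by (simp add: D_def Y_def M_def H_def power_mult_distrib power_divide power_mult[symmetric])
    ultimately show "6 * real m * (2 * (real h)\<^sup>2 * q + 8 * real h)\<^sup>2 +
      2 * (real m)\<^sup>2 * (12 * (real h)\<^sup>2 * A' + 12 * real h ^ 3 * B) \<le> D / 6"
      unfolding M_def[symmetric] H_def[symmetric] using t1 t2 t3 t4 by linarith
  qed
  finally show ?thesis using D by simp
qed

text \<open>The weights are themselves random: by Markov's inequality the flattening batch fails to make
  them balanced with probability at most \<open>1/6\<close>.\<close>

lemma flat_test_error:
  fixes S :: "'s pmf" and \<sigma> :: "'s \<Rightarrow> 'a \<Rightarrow> real" and h m k :: nat and \<tau> :: real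
  assumes fin_S: "finite (set_pmf S)"
    and pairs: "\<And>i j. i \<in> I \<Longrightarrow> j \<in> I \<Longrightarrow> mean S (\<lambda>s. \<sigma> s i * \<sigma> s j) = of_bool (i = j)"
    and quads: "\<And>i j k l. i \<in> I \<Longrightarrow> j \<in> I \<Longrightarrow> k \<in> I \<Longrightarrow> l \<in> I \<Longrightarrow>
       mean S (\<lambda>s. \<sigma> s i * \<sigma> s j * (\<sigma> s k * \<sigma> s l)) =
       of_bool ((i = j \<and> k = l) \<or> (i = k \<and> j = l) \<or> (i = l \<and> j = k))"
    and m: "10000 \<le> m" "76800 \<le> real m * (real h * \<tau>)\<^sup>2"
    and k: "96 \<le> (real k + 1) * (real h * \<tau> / 1200)\<^sup>2"
    and \<tau>: "0 < \<tau>" and h: "0 < h"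
  defines "q \<equiv> \<lambda>f. \<Sum>i\<in>I. (flat_wt f i)\<^sup>2 * (\<delta> i)\<^sup>2"
  assumes W: "\<And>f z z' ss. f \<in> set_pmf (batch k a b) \<Longrightarrow> W f z z' ss \<Longrightarrow>
      real m * (real h)\<^sup>2 * max (q f) \<tau> / 2 \<le>
      \<bar>sketch_stat (\<lambda>s i. \<sigma> s i * flat_wt f i) ss z z' - real m * ((real h)\<^sup>2 * q f)\<bar>"
  shows "mean (batch k a b) (\<lambda>f. mean (batch h a b) (\<lambda>z. mean (batch h a b) (\<lambda>z'.
      mean (replicate_pmf m S) (\<lambda>ss. of_bool (W f z z' ss))))) \<le> 1 / 3"
proof -
  let ?P = "batch h a b"
  let ?R = "replicate_pmf m S"
  define A where "A = (\<lambda>f. \<Sum>i\<in>I. ((flat_wt f i)\<^sup>2 * \<rho> i)\<^sup>2)"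
  define A0 where "A0 = (real h * \<tau> / 1200)\<^sup>2"
  have A0: "0 < A0" using h \<tau> by (simp add: A0_def)
  have A_nonneg: "0 \<le> A f" for f by (simp add: A_def sum_nonneg)
  have fin_R: "finite (set_pmf ?R)" using fin_S by simp
  have "mean (batch k a b) (\<lambda>f. mean ?P (\<lambda>z. mean ?P (\<lambda>z'. mean ?R (\<lambda>ss. of_bool (W f z z' ss))))) \<le>
    mean (batch k a b) (\<lambda>f. 1 / 6 + A f / A0)"
  proof (intro mean_mono finite_batch)
    fix f assume f: "f \<in> set_pmf (batch k a b)"
    show "mean ?P (\<lambda>z. mean ?P (\<lambda>z'. mean ?R (\<lambda>ss. of_bool (W f z z' ss)))) \<le> 1 / 6 + A f / A0"
    proof (cases "A f \<le> A0")
      case True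
      have "mean ?P (\<lambda>z. mean ?P (\<lambda>z'. mean ?R (\<lambda>ss. of_bool (W f z z' ss)))) \<le> 1 / 6"
        by (rule batch_test_error[OF fin_S pairs quads flat_square_le_1 True[unfolded A_def A0_def] m \<tau> h])
          (use W[OF f] in \<open>simp_all add: q_def\<close>)
      moreover have "0 \<le> A f / A0" using A0 A_nonneg by simp
      ultimately show ?thesis by linarith
    next
      case False
      have "mean ?P (\<lambda>z. mean ?P (\<lambda>z'. mean ?R (\<lambda>ss. of_bool (W f z z' ss)))) \<le>
        mean ?P (\<lambda>z. mean ?P (\<lambda>z'. mean ?R (\<lambda>ss. 1)))"
        by (intro mean_mono finite_batch fin_R) simp
      also have "\<dots> = 1" by simp
      also have "1 \<le> A f / A0" using False A0 by simp
      finally show ?thesis by simp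
    qed
  qed
  also have "\<dots> = 1 / 6 + mean (batch k a b) A / A0"
    by (simp add: mean_add)
  also have "\<dots> \<le> 1 / 6 + 16 / (real k + 1) / A0"
    using mean_flat_rho_le[of k] A0 unfolding A_def by (intro add_left_mono divide_right_mono) auto
  \<comment> \<open>The hypothesis \<open>k\<close> is made for this line:
    \<open>96 = 6 * 16\<close>.\<close>
  also have "\<dots> \<le> 1 / 6 + 1 / 6"
    using k A0 unfolding A0_def[symmetric] by (simp add: field_simps)
  finally show ?thesis by simp
qed

end

section \<open>The protocol\<close>

text \<open>A list of independent samples is a concatenation of independent batches. The
  \<open>e\<close> surplus samples integrate out, so every sufficiently large \<open>t\<close> is
  admissible.\<close>

lemma bind_replicate_pmf_split:
  assumes "k + h + h \<le> t"
  shows "bind_pmf (replicate_pmf t p) (\<lambda>x. G (take k x) (take h (drop k x)) (take h (drop (k + h) x))) =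
    bind_pmf (replicate_pmf k p) (\<lambda>x1. bind_pmf (replicate_pmf h p) (\<lambda>x2.
      bind_pmf (replicate_pmf h p) (\<lambda>x3. G x1 x2 x3)))"
proof -
  obtain e where t: "t = k + (h + (h + e))" using assms le_Suc_ex by (metis add.assoc)
  show ?thesis
    unfolding t replicate_pmf_distrib bind_assoc_pmf bind_return_pmf
  proof (intro bind_pmf_cong refl)
    fix x1 x2 x3
    assume "x1 \<in> set_pmf (replicate_pmf k p)" "x2 \<in> set_pmf (replicate_pmf h p)"
      "x3 \<in> set_pmf (replicate_pmf h p)"
    then have "length x1 = k" "length x2 = h" "length x3 = h" by (auto simp: set_replicate_pmf)
    then show "bind_pmf (replicate_pmf e p) (\<lambda>x4. G (take k (x1 @ x2 @ x3 @ x4))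
        (take h (drop k (x1 @ x2 @ x3 @ x4))) (take h (drop (k + h) (x1 @ x2 @ x3 @ x4)))) = G x1 x2 x3"
      by simp
  qed
qed

lemma bind_commute_pmf2:
  "bind_pmf A (\<lambda>x. bind_pmf B (\<lambda>y. bind_pmf C (\<lambda>z. K x y z))) =
   bind_pmf C (\<lambda>z. bind_pmf A (\<lambda>x. bind_pmf B (\<lambda>y. K x y z)))"
proof -
  have "bind_pmf A (\<lambda>x. bind_pmf B (\<lambda>y. bind_pmf C (\<lambda>z. K x y z))) =
    bind_pmf A (\<lambda>x. bind_pmf C (\<lambda>z. bind_pmf B (\<lambda>y. K x y z)))"
    by (intro bind_pmf_cong refl bind_commute_pmf)
  also have "\<dots> = bind_pmf C (\<lambda>z. bind_pmf A (\<lambda>x. bind_pmf B (\<lambda>y. K x y z)))"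
    by (rule bind_commute_pmf)
  finally show ?thesis .
qed

lemma bind_batch:
  "bind_pmf (batch h a b) F = bind_pmf (replicate_pmf h a) (\<lambda>x. bind_pmf (replicate_pmf h b) (\<lambda>y. F (x, y)))"
  by (simp add: batch_def pair_pmf_def bind_assoc_pmf bind_return_pmf)

text \<open>\<open>ct_answer\<close> draws all of Alice's samples before Bob's, whereas the analysis
  pairs the corresponding batches of both; independent draws commute. Only Alice uses randomness, so
  Bob's coins are the constant empty list.\<close>

lemma ct_answer_batches:
  assumes t: "k + h + h \<le> t"
    and run: "\<And>x y r. x \<in> set_pmf (replicate_pmf t a) \<Longrightarrow> y \<in> set_pmf (replicate_pmf t b) \<Longrightarrow> r \<in> set_pmf R \<Longrightarrow>
      run P (x, enc r) (y, []) = F (take k x, take k y) (take h (drop k x), take h (drop k y))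
        (take h (drop (k + h) x), take h (drop (k + h) y)) r"
  shows "ct_answer t (map_pmf enc R) (return_pmf []) P a b =
    bind_pmf (batch k a b) (\<lambda>f. bind_pmf (batch h a b) (\<lambda>z. bind_pmf (batch h a b) (\<lambda>z'.
      bind_pmf R (\<lambda>r. return_pmf (F f z z' r)))))"
proof -
  let ?G = "\<lambda>x1 x2 x3 y1 y2 y3. bind_pmf R (\<lambda>r. return_pmf (F (x1, y1) (x2, y2) (x3, y3) r))"
  let ?ka = "replicate_pmf k a" and ?ha = "replicate_pmf h a"
  let ?kb = "replicate_pmf k b" and ?hb = "replicate_pmf h b"
  have "ct_answer t (map_pmf enc R) (return_pmf []) P a b =
    bind_pmf (replicate_pmf t a) (\<lambda>x. bind_pmf (replicate_pmf t b) (\<lambda>y.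
      ?G (take k x) (take h (drop k x)) (take h (drop (k + h) x))
         (take k y) (take h (drop k y)) (take h (drop (k + h) y))))"
    unfolding ct_answer_def bind_map_pmf bind_return_pmf
    by (intro bind_pmf_cong refl) (simp add: run)
  also have "\<dots> = bind_pmf (replicate_pmf t a) (\<lambda>x.
      bind_pmf ?kb (\<lambda>y1. bind_pmf ?hb (\<lambda>y2. bind_pmf ?hb (\<lambda>y3.
      ?G (take k x) (take h (drop k x)) (take h (drop (k + h) x)) y1 y2 y3))))"
    by (intro bind_pmf_cong refl bind_replicate_pmf_split[OF t])
  also have "\<dots> = bind_pmf ?ka (\<lambda>x1. bind_pmf ?ha (\<lambda>x2. bind_pmf ?ha (\<lambda>x3.
      bind_pmf ?kb (\<lambda>y1. bind_pmf ?hb (\<lambda>y2. bind_pmf ?hb (\<lambda>y3. ?G x1 x2 x3 y1 y2 y3))))))"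
    by (rule bind_replicate_pmf_split[OF t])
  also have "\<dots> = bind_pmf ?ka (\<lambda>x1. bind_pmf ?kb (\<lambda>y1. bind_pmf ?ha (\<lambda>x2. bind_pmf ?ha (\<lambda>x3.
      bind_pmf ?hb (\<lambda>y2. bind_pmf ?hb (\<lambda>y3. ?G x1 x2 x3 y1 y2 y3))))))"
    by (intro bind_pmf_cong refl bind_commute_pmf2)
  also have "\<dots> = bind_pmf ?ka (\<lambda>x1. bind_pmf ?kb (\<lambda>y1. bind_pmf ?ha (\<lambda>x2. bind_pmf ?hb (\<lambda>y2.
      bind_pmf ?ha (\<lambda>x3. bind_pmf ?hb (\<lambda>y3. ?G x1 x2 x3 y1 y2 y3))))))"
    by (intro bind_pmf_cong refl bind_commute_pmf)
  finally show ?thesis unfolding bind_batch .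
qed

lemma pmf_bind_return_mean:
  "pmf (bind_pmf A (\<lambda>f. bind_pmf B (\<lambda>z. bind_pmf C (\<lambda>z'. bind_pmf R (\<lambda>r. return_pmf (F f z z' r)))))) v =
   mean A (\<lambda>f. mean B (\<lambda>z. mean C (\<lambda>z'. mean R (\<lambda>r. of_bool (F f z z' r = v)))))"
proof -
  have "indicator {v} x = (of_bool (x = v) :: real)" for x by (auto simp: indicator_def)
  then show ?thesis by (simp add: pmf_bind)
qed

text \<open>Every summand is a signed multiple of \<open>1 / 2 ^ R\<close> of size at most 1. The
  sketches therefore range over a finite set and can be sent without rounding.\<close>

lemma sketch_value:
  fixes \<sigma> :: "'a \<Rightarrow> real" and e :: "'a \<Rightarrow> nat"
  assumes \<sigma>: "\<And>i. \<sigma> i \<in> {-1, 1}" and e: "\<And>i. e i \<le> R"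
  shows "\<exists>c :: int. \<bar>c\<bar> \<le> 2 ^ R * int (length xs) \<and>
    sum_list (map (\<lambda>i. \<sigma> i * (1 / 2 ^ e i)) xs) = of_int c / 2 ^ R"
proof (induction xs)
  case (Cons x xs)
  then obtain c :: int where c: "\<bar>c\<bar> \<le> 2 ^ R * int (length xs)"
    "sum_list (map (\<lambda>i. \<sigma> i * (1 / 2 ^ e i)) xs) = of_int c / 2 ^ R" by blast
  obtain s :: int where s: "s \<in> {-1, 1}" "\<sigma> x = of_int s"
    using \<sigma>[of x] by (metis insert_iff of_int_1 of_int_minus singletonD)
  have "\<bar>s * 2 ^ (R - e x)\<bar> \<le> 2 ^ R"
    using s(1) by (auto intro: power_increasing)
  then have "\<bar>s * 2 ^ (R - e x) + c\<bar> \<le> 2 ^ R * int (length (x # xs))"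
    using c(1) by (simp add: algebra_simps)
  moreover have p: "(1 :: real) / 2 ^ e x = 2 ^ (R - e x) / 2 ^ R"
    using e[of x] by (simp add: power_diff)
  have "sum_list (map (\<lambda>i. \<sigma> i * (1 / 2 ^ e i)) (x # xs)) = of_int (s * 2 ^ (R - e x) + c) / 2 ^ R"
    unfolding list.map sum_list.Cons c(2) s(2) p by (simp add: add_divide_distrib)
  ultimately show ?case by blast
qed simp

lemma count_list_le_length: "count_list xs i \<le> length xs"
  by (induction xs) auto

text \<open>Bob sends \<open>k\<close> samples; Alice replies with \<open>k\<close> samples and
  \<open>m\<close> triples of a seed and two sketches. The hypotheses on \<open>l\<close> make each
  sample, seed and sketch fit into \<open>l\<close> bits and provide enough seeds for four-wise
  independent signs.\<close>

lemma protocol_exists: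
  fixes n t k h m l :: nat and \<epsilon> \<tau> :: real
  assumes t: "k + h + h \<le> t"
    and l: "n ^ 3 < 2 ^ l" "2 * ((1 + 2 * k) * h) + 1 \<le> 2 ^ l"
    and m: "10000 \<le> m" "76800 \<le> real m * (real h * \<tau>)\<^sup>2"
    and k: "96 \<le> (real k + 1) * (real h * \<tau> / 1200)\<^sup>2"
    and \<tau>: "0 < \<tau>" "\<tau> * (real n + 2 * real k) \<le> \<epsilon>\<^sup>2" and h: "0 < h" and \<epsilon>: "0 < \<epsilon>"
  shows "\<exists>RA RB P. solves_CT n t \<epsilon> RA RB P \<and> comm_cost P \<le> l * k + ((l * k + 3 * l * m) + 1)"
proof -
  define I where "I = {1..n}"
  have fin_I: "finite I" and card_I: "card I = n" by (simp_all add: I_def)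
  obtain \<sigma> :: "nat set \<Rightarrow> nat \<Rightarrow> real" where
    \<sigma>: "\<And>s i. \<sigma> s i \<in> {-1, 1}"
    and pairs: "\<And>i j. i \<in> I \<Longrightarrow> j \<in> I \<Longrightarrow> mean (seeds l) (\<lambda>s. \<sigma> s i * \<sigma> s j) = of_bool (i = j)"
    and quads: "\<And>i j k' l'. i \<in> I \<Longrightarrow> j \<in> I \<Longrightarrow> k' \<in> I \<Longrightarrow> l' \<in> I \<Longrightarrow>
       mean (seeds l) (\<lambda>s. \<sigma> s i * \<sigma> s j * (\<sigma> s k' * \<sigma> s l')) =
       of_bool ((i = j \<and> k' = l') \<or> (i = k' \<and> j = l') \<or> (i = l' \<and> j = k'))"
    using four_wise_signs[OF fin_I, of l] l(1) unfolding card_I by blast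
  define ph where "ph = (\<lambda>f s i. \<sigma> s i * flat_wt f i)"
  define sk where "sk = (\<lambda>f s xs. sum_list (map (ph f s) xs))"
  \<comment> \<open>Half of \<open>m * h\<^sup>2 * \<tau>\<close>, the least mean of the statistic
    in the far case.\<close>
  define \<theta> where "\<theta> = real m * (real h)\<^sup>2 * \<tau> / 2"

  \<comment> \<open>A symbol occurs at most \<open>2 * k\<close> times among the flattening samples,
    so \<open>2 ^ R\<close> is a common denominator of all weights.\<close>
  define R where "R = lev (2 * k)"
  define V where "V = (\<lambda>c :: int. real_of_int c / 2 ^ R) ` {- (2 ^ R * int h)..2 ^ R * int h}"
  define SB where "SB = {xs. set xs \<subseteq> I \<and> length xs = k}"
  define SQ where "SQ = {q. set q \<subseteq> Pow {..<l} \<times> V \<times> V \<and> length q = m}"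
  have fin_V: "finite V" by (simp add: V_def)
  have "card V \<le> card {- (2 ^ R * int h)..2 ^ R * int h}"
    unfolding V_def by (rule card_image_le) simp
  also have "\<dots> = 2 * (2 ^ R * h) + 1"
  proof -
    have "2 ^ R * int h = int (2 ^ R * h)" by simp
    then show ?thesis by (simp only: card_atLeastAtMost_int)
  qed
  also have "\<dots> \<le> 2 * ((1 + 2 * k) * h) + 1"
  proof -
    have "(2 :: nat) ^ R \<le> 4 ^ R" by (rule power_mono) auto
    also have "\<dots> \<le> 1 + 2 * k" unfolding R_def by (rule lev_lower)
    finally show ?thesis by (intro add_right_mono mult_left_mono mult_right_mono) simp_all
  qed
  finally have card_V: "card V \<le> 2 ^ l" using l(2) by linarith
  have fin_SB: "finite SB" unfolding SB_def by (rule finite_lists_length_eq[OF fin_I])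
  have fin_SQ: "finite SQ" unfolding SQ_def using fin_V by (intro finite_lists_length_eq) auto
  have "n \<le> n ^ 3" by (cases n) (auto simp: power3_eq_cube)
  then have "n \<le> 2 ^ l" using l(1) by linarith
  then have card_SB: "card SB \<le> 2 ^ (l * k)"
    unfolding SB_def card_lists_length_eq[OF fin_I] card_I power_mult by (rule power_mono) simp
  have "card (Pow {..<l} \<times> V \<times> V) \<le> 2 ^ l * (2 ^ l * 2 ^ l)"
    unfolding card_cartesian_product using card_V by (intro mult_mono) (auto simp: card_Pow)
  also have "\<dots> = 2 ^ (3 * l)"
    by (simp add: power_add[symmetric])
  finally have "card SQ \<le> (2 ^ (3 * l)) ^ m"
    unfolding SQ_def using fin_V by (subst card_lists_length_eq) (auto intro: power_mono)
  then have "card (SB \<times> SQ) \<le> 2 ^ (l * k) * 2 ^ (3 * l * m)"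
    unfolding card_cartesian_product power_mult[symmetric] using card_SB by (intro mult_mono) auto
  then have card_T: "card (SB \<times> SQ) \<le> 2 ^ (l * k + 3 * l * m)"
    by (simp only: power_add)

  define SS where "SS = set_pmf (replicate_pmf m (seeds l))"
  have fin_SS: "finite SS" by (simp add: SS_def)
  \<comment> \<open>Coins are bit lists, so the drawn seeds are stored under an injective encoding.
    Its length is not charged: the seeds are sent afresh within Alice's message.\<close>
  obtain enc :: "nat set list \<Rightarrow> bool list" where enc: "inj_on enc SS"
  proof -
    have "card SS \<le> card {bs :: bool list. set bs \<subseteq> UNIV \<and> length bs = card SS}"
      unfolding card_lists_length_eq[OF finite] using less_exp[of "card SS"] by simp
    then show ?thesis
      using card_le_inj[OF fin_SS finite_lists_length_eq[OF finite]] that by blast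
  qed
  define dec where "dec = inv_into SS enc"
  have dec: "dec (enc ss) = ss" if "ss \<in> SS" for ss
    using enc that by (simp add: dec_def)

  \<comment> \<open>\<open>f\<close> is Bob's message, \<open>g\<close> Alice's reply to it and
    \<open>d\<close> Bob's verdict. Bob alone subtracts his sketches from those received.\<close>
  define f :: "samples \<times> coins \<Rightarrow> nat list" where "f = (\<lambda>(y, _). take k y)"
  define g :: "nat list \<Rightarrow> samples \<times> coins \<Rightarrow> nat list \<times> (nat set \<times> real \<times> real) list" where
    "g = (\<lambda>yk (x, r). (take k x, map (\<lambda>s. (s, sk (take k x, yk) s (take h (drop k x)),
       sk (take k x, yk) s (take h (drop (k + h) x)))) (dec r)))"
  define d :: "nat list \<Rightarrow> nat list \<times> (nat set \<times> real \<times> real) list \<Rightarrow> samples \<times> coins \<Rightarrow> bool" where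
    "d = (\<lambda>yk (xk, q) (y, _). sum_list (map (\<lambda>(s, p, p').
       (p - sk (xk, yk) s (take h (drop k y))) * (p' - sk (xk, yk) s (take h (drop (k + h) y)))) q) < \<theta>)"
  obtain P where cost: "comm_cost P \<le> l * k + ((l * k + 3 * l * m) + 1)"
    and run: "\<And>x y. f y \<in> SB \<Longrightarrow> g (f y) x \<in> SB \<times> SQ \<Longrightarrow> run P x y = d (f y) (g (f y) x) y"
    using two_message_protocol[OF fin_SB card_SB finite_cartesian_product[OF fin_SB fin_SQ] card_T,
      of f g d] by blast

  have ph_V: "sk fl s xs \<in> V"
    if len: "length xs = h" "length (fst fl) = k" "length (snd fl) = k" for fl s xs
  proof -
    have "lev (count_list (fst fl) i + count_list (snd fl) i) \<le> R" for i
      unfolding R_def using count_list_le_length[of "fst fl" i] count_list_le_length[of "snd fl" i] that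
      by (intro lev_mono) simp
    from sketch_value[where \<sigma>="\<sigma> s" and xs=xs
        and e="\<lambda>i. lev (count_list (fst fl) i + count_list (snd fl) i)", OF \<sigma> this] obtain c :: int where
      "\<bar>c\<bar> \<le> 2 ^ R * int h" "sk fl s xs = of_int c / 2 ^ R"
      unfolding sk_def ph_def flat_wt_def len(1) by blast
    then show ?thesis unfolding V_def by (intro image_eqI[of _ _ c]) auto
  qed

  have run_stat: "run P (x, enc ss) (y, []) =
      (sketch_stat (ph (take k x, take k y)) ss (take h (drop k x), take h (drop k y))
        (take h (drop (k + h) x), take h (drop (k + h) y)) < \<theta>)"
    if supp: "set_pmf a \<subseteq> I" "set_pmf b \<subseteq> I"
      and x: "x \<in> set_pmf (replicate_pmf t a)" and y: "y \<in> set_pmf (replicate_pmf t b)"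
      and ss: "ss \<in> set_pmf (replicate_pmf m (seeds l))" for a b x y ss
  proof -
    have len: "length x = t" "length y = t" using x y by (auto simp: set_replicate_pmf)
    have set: "set x \<subseteq> I" "set y \<subseteq> I" using x y supp by (auto simp: set_replicate_pmf)
    have ssm: "length ss = m" "set ss \<subseteq> Pow {..<l}"
      using ss by (auto simp: set_replicate_pmf set_seeds)
    have d: "dec (enc ss) = ss" using dec ss by (simp add: SS_def)
    have "f (y, []) \<in> SB" using len set t set_take_subset[of k y] by (auto simp: f_def SB_def)
    moreover have "g (f (y, [])) (x, enc ss) \<in> SB \<times> SQ"
    proof -
      have "take k x \<in> SB" using len set t set_take_subset[of k x] by (auto simp: SB_def)
      moreover have "sk (take k x, take k y) s (take h (drop k x)) \<in> V"
        "sk (take k x, take k y) s (take h (drop (k + h) x)) \<in> V" for s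
        using len t by (auto intro!: ph_V)
      ultimately show ?thesis
        using ssm by (auto simp: g_def f_def d SQ_def)
    qed
    ultimately have "run P (x, enc ss) (y, []) = d (f (y, [])) (g (f (y, [])) (x, enc ss)) (y, [])"
      by (rule run)
    then show ?thesis
      by (simp add: d_def g_def f_def d sketch_stat_def lin_def sk_def o_def)
  qed

  have "solves_CT n t \<epsilon> (map_pmf enc (replicate_pmf m (seeds l))) (return_pmf []) P"
    unfolding solves_CT_def
  proof (intro allI impI conjI)
    fix a b assume dist: "distribution_on n a" "distribution_on n b"
    then interpret two_sources I a b
      using fin_I by unfold_locales (auto simp: distribution_on_def I_def)
    let ?ans = "ct_answer t (map_pmf enc (replicate_pmf m (seeds l))) (return_pmf []) P a b"
    have ans: "pmf ?ans v = mean (batch k a b) (\<lambda>f. mean (batch h a b) (\<lambda>z. mean (batch h a b) (\<lambda>z'.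
        mean (replicate_pmf m (seeds l)) (\<lambda>ss. of_bool ((sketch_stat (ph f) ss z z' < \<theta>) = v)))))" for v
    proof -
      have "?ans = bind_pmf (batch k a b) (\<lambda>f. bind_pmf (batch h a b) (\<lambda>z. bind_pmf (batch h a b) (\<lambda>z'.
        bind_pmf (replicate_pmf m (seeds l)) (\<lambda>ss. return_pmf (sketch_stat (ph f) ss z z' < \<theta>)))))"
        by (rule ct_answer_batches[OF t]) (rule run_stat[OF supp_a supp_b])
      then show ?thesis by (simp only: pmf_bind_return_mean)
    qed
    note error = flat_test_error[OF finite_set_seeds pairs quads m k \<tau>(1) h]
    {
      assume ab: "a = b"
      \<comment> \<open>Here \<open>q = 0\<close>, and a wrong answer means that the statistic is at
        least \<open>\<theta>\<close>, which is exactly the deviation that \<open>error\<close> asks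
        for.\<close>
      have \<delta>0: "\<delta> i = 0" for i unfolding \<delta>_def by (simp add: ab)
      have "pmf ?ans False \<le> 1 / 3"
        unfolding ans ph_def
        by (rule error) (use \<tau>(1) in \<open>auto simp: \<delta>0 \<theta>_def max_def\<close>)
      then show "2 / 3 \<le> pmf ?ans True" by (simp add: pmf_False_conv_True)
    }
    {
      assume far: "\<epsilon> \<le> l1_dist n a b"
      have q: "\<tau> \<le> (\<Sum>i\<in>I. (flat_wt f i)\<^sup>2 * (\<delta> i)\<^sup>2)" if "f \<in> set_pmf (batch k a b)" for f
      proof -
        have "\<epsilon>\<^sup>2 \<le> (\<Sum>i\<in>I. \<bar>\<delta> i\<bar>)\<^sup>2"
          using far \<epsilon> by (intro power_mono) (auto simp: l1_dist_def I_def \<delta>_def)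
        also have "\<dots> \<le> (\<Sum>i\<in>I. (flat_wt f i)\<^sup>2 * (\<delta> i)\<^sup>2) * (real n + 2 * real k)"
          using flat_l2_ge[OF that] by (simp add: card_I)
        finally have "\<tau> * (real n + 2 * real k) \<le>
            (\<Sum>i\<in>I. (flat_wt f i)\<^sup>2 * (\<delta> i)\<^sup>2) * (real n + 2 * real k)"
          using \<tau>(2) by linarith
        moreover have "0 < real n + 2 * real k"
        proof (rule ccontr)
          assume "\<not> 0 < real n + 2 * real k"
          then have "n = 0" by simp
          then show False using far \<epsilon> by (simp add: l1_dist_def)
        qed
        ultimately show ?thesis by simp
      qed
      have "pmf ?ans True \<le> 1 / 3"
        unfolding ans ph_def
      proof (rule error)
        fix f z z' ss
        let ?q = "\<Sum>i\<in>I. (flat_wt f i)\<^sup>2 * (\<delta> i)\<^sup>2"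
        let ?st = "sketch_stat (\<lambda>s i. \<sigma> s i * flat_wt f i) ss z z'"
        assume f: "f \<in> set_pmf (batch k a b)" and less: "(?st < \<theta>) = True"
        \<comment> \<open>The mean is at least \<open>2 * \<theta>\<close>, so a statistic below
          \<open>\<theta>\<close> misses it by more than half of it.\<close>
        have "real m * (real h)\<^sup>2 * \<tau> \<le> real m * (real h)\<^sup>2 * ?q"
          using q[OF f] by (intro mult_left_mono) auto
        moreover have "?st < real m * (real h)\<^sup>2 * \<tau> / 2"
          using less by (simp add: \<theta>_def)
        ultimately show "real m * (real h)\<^sup>2 * max ?q \<tau> / 2 \<le> \<bar>?st - real m * ((real h)\<^sup>2 * ?q)\<bar>"
          unfolding max.absorb1[OF q[OF f]] mult.assoc[symmetric] by linarith
      qed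
      then show "2 / 3 \<le> pmf ?ans False" by (simp add: pmf_False_conv_True)
    }
  qed
  with cost show ?thesis by blast
qed

section \<open>Parameters\<close>

lemma power_two_exceeds:
  fixes r :: real
  assumes "1 \<le> r"
  obtains l :: nat where "10 ^ 8 * r ^ 3 < 2 ^ l" "1 \<le> l" "real l \<le> 28 * (1 + ln r)"
proof -
  \<comment> \<open>\<open>2 ^ 27\<close> exceeds \<open>10 ^ 8\<close>, so \<open>2 powr L\<close>
    dominates \<open>10 ^ 8 * r ^ 3\<close>.\<close>
  define L where "L = 27 + 3 * log 2 r"
  have L0: "0 \<le> log 2 r" using assms by simp
  define l where "l = nat \<lfloor>L\<rfloor> + 1"
  have "L < real l" unfolding l_def using L0 by (simp add: L_def) linarith
  have "(10 :: real) ^ 8 * r ^ 3 \<le> 2 powr L"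
  proof -
    have "2 powr (3 * log 2 r) = r ^ 3"
      using assms by (simp add: mult.commute[of 3] powr_powr[symmetric])
    then have "2 powr L = 2 ^ 27 * r ^ 3" by (simp add: L_def powr_add)
    then show ?thesis using assms by simp
  qed
  also have "\<dots> < 2 powr real l" using \<open>L < real l\<close> by simp
  also have "\<dots> = 2 ^ l" by (simp add: powr_realpow)
  finally have 1: "10 ^ 8 * r ^ 3 < 2 ^ l" .
  have ln2: "1 / 2 \<le> ln (2 :: real)" using ln2_ge_two_thirds by simp
  have "log 2 r = ln r / ln 2" by (simp add: log_def)
  also have "\<dots> \<le> ln r / (1 / 2)" using ln2 assms by (intro divide_left_mono) auto
  finally have "log 2 r \<le> 2 * ln r" by simp
  moreover have "real l \<le> L + 1" unfolding l_def using L0 by (simp add: L_def)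
  moreover have "0 \<le> ln r" using assms by simp
  ultimately have "real l \<le> 28 * (1 + ln r)" unfolding L_def by (simp add: algebra_simps)
  with 1 show ?thesis by (intro that[of l]) (auto simp: l_def)
qed

text \<open>Squaring the lower bound \<open>C * sqrt n / \<epsilon>^2\<close> on \<open>t\<close>
  gives the estimate by \<open>n\<close>; cubing the one with exponents \<open>2 / 3\<close> and
  \<open>- 4 / 3\<close> gives the estimate by \<open>t\<close>. They keep the number of flattening
  samples below \<open>n\<close> and \<open>t\<close>, up to constants.\<close>

lemma sample_size_bounds:
  fixes n t :: nat and \<epsilon> C :: real
  assumes n: "n > 1" and \<epsilon>: "0 < \<epsilon>" "\<epsilon> \<le> 2" and C: "0 < C"
    and t: "real t \<ge> C * max (real n powr (2 / 3) * \<epsilon> powr (- 4 / 3)) (sqrt (real n) / \<epsilon> ^ 2)"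
  shows "C / 4 \<le> real t"
    and "real n ^ 2 / (real t ^ 2 * \<epsilon> ^ 4) \<le> real n / C ^ 2"
    and "real n ^ 2 / (real t ^ 2 * \<epsilon> ^ 4) \<le> real t / C ^ 3"
proof -
  have t1: "C * (real n powr (2 / 3) * \<epsilon> powr (- 4 / 3)) \<le> real t"
    using t C by (meson max.cobounded1 mult_left_mono less_imp_le order_trans)
  have t2: "C * (sqrt (real n) / \<epsilon> ^ 2) \<le> real t"
    using t C by (meson max.cobounded2 mult_left_mono less_imp_le order_trans)
  have "\<epsilon> ^ 2 \<le> 2 ^ 2" using \<epsilon> by (intro power_mono) auto
  then have "1 / 4 \<le> sqrt (real n) / \<epsilon> ^ 2" using n \<epsilon> by (intro frac_le) auto
  then have "C * (1 / 4) \<le> C * (sqrt (real n) / \<epsilon> ^ 2)" using C by (intro mult_left_mono) auto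
  with t2 show t4: "C / 4 \<le> real t" by linarith
  then have tpos: "0 < real t" using C by linarith
  have "(C * (sqrt (real n) / \<epsilon> ^ 2)) ^ 2 \<le> real t ^ 2" using t2 C \<epsilon> by (intro power_mono) auto
  then have "C ^ 2 * (real n / \<epsilon> ^ 4) \<le> real t ^ 2"
    by (simp add: power_mult_distrib power_divide power_mult[symmetric])
  then have "C ^ 2 * real n \<le> real t ^ 2 * \<epsilon> ^ 4" using \<epsilon> by (simp add: field_simps)
  then have "real n * (C ^ 2 * real n) \<le> real n * (real t ^ 2 * \<epsilon> ^ 4)" by (intro mult_left_mono) auto
  then show "real n ^ 2 / (real t ^ 2 * \<epsilon> ^ 4) \<le> real n / C ^ 2"
    using C \<epsilon> tpos by (simp add: frac_le_eq divide_simps power2_eq_square mult_ac)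
  have "(C * (real n powr (2 / 3) * \<epsilon> powr (- 4 / 3))) ^ 3 \<le> real t ^ 3"
    using t1 C by (intro power_mono) auto
  moreover have "(real n powr (2 / 3)) ^ 3 = real n ^ 2"
    using n by (simp add: powr_power)
  moreover have "(\<epsilon> powr (- 4 / 3)) ^ 3 = 1 / \<epsilon> ^ 4"
  proof -
    have "(\<epsilon> powr (- 4 / 3)) ^ 3 = \<epsilon> powr (- 4)" using \<epsilon> by (simp add: powr_power)
    also have "\<dots> = 1 / \<epsilon> ^ 4" using \<epsilon> by (simp add: powr_minus_divide)
    finally show ?thesis .
  qed
  ultimately have "C ^ 3 * (real n ^ 2 / \<epsilon> ^ 4) \<le> real t ^ 3"
    by (simp add: power_mult_distrib)
  then have "C ^ 3 * real n ^ 2 \<le> real t * (real t ^ 2 * \<epsilon> ^ 4)"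
    using \<epsilon> by (simp add: field_simps power3_eq_cube power2_eq_square)
  then show "real n ^ 2 / (real t ^ 2 * \<epsilon> ^ 4) \<le> real t / C ^ 3"
    using C \<epsilon> tpos by (simp add: divide_simps mult_ac)
qed

lemma real_nat_ceiling_less: "0 < z \<Longrightarrow> real (nat \<lceil>z\<rceil>) < z + 1"
  by linarith

lemma CT_solvable:
  fixes n t :: nat and \<epsilon> :: real
  assumes n: "n > 1" and \<epsilon>: "0 < \<epsilon>" "\<epsilon> \<le> 2"
    and t: "real t \<ge> 10 ^ 6 * max (real n powr (2 / 3) * \<epsilon> powr (- 4 / 3)) (sqrt (real n) / \<epsilon> ^ 2)"
  shows "CT_solvable_with n t \<epsilon>
    (10 ^ 18 * (1 + ln (real n / \<epsilon>)) * (real n ^ 2 / (real t ^ 2 * \<epsilon> ^ 4) + 1))"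
proof -
  define y where "y = real n ^ 2 / (real t ^ 2 * \<epsilon> ^ 4)"
  note bounds = sample_size_bounds[OF n \<epsilon> _ t, folded y_def]
  have t4: "250000 \<le> real t" and yn: "y \<le> real n / 10 ^ 12" and yt: "y \<le> real t / 10 ^ 18"
    using bounds by simp_all
  have y0: "0 \<le> y" by (simp add: y_def)
  define N where "N = real n / \<epsilon>\<^sup>2"
  have "\<epsilon>\<^sup>2 \<le> 2\<^sup>2" using \<epsilon> by (intro power_mono) auto
  then have "2 / 4 \<le> N" unfolding N_def using n \<epsilon> by (intro frac_le) auto
  then have N: "1 / 2 \<le> N" by simp
  \<comment> \<open>A third of the samples leaves room for two batches and the flattening. The cap
    keeps \<open>h\<close>, and with it the size of the sketches, polynomial in
    \<open>n / \<epsilon>\<close> however large \<open>t\<close> is.\<close>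
  define h where "h = min (t div 3) (nat \<lfloor>10 ^ 6 * N\<rfloor>)"
  \<comment> \<open>For the \<open>\<tau>\<close> chosen below,
    \<open>(h * \<tau>)\<^sup>2 = 1 / (25 * x)\<close>, so \<open>k\<close> and \<open>m\<close>
    have to be of order \<open>x\<close>.\<close>
  define x where "x = (N / real h)\<^sup>2"
  have "real h \<le> real (nat \<lfloor>10 ^ 6 * N\<rfloor>)" unfolding h_def by simp
  also have "\<dots> \<le> 10 ^ 6 * N" using N by (intro of_nat_floor) simp
  finally have h_le: "real h \<le> 10 ^ 6 * N" .
  have yN: "y = (N / real t)\<^sup>2"
    by (simp add: y_def N_def power_divide power_mult[symmetric] power_mult_distrib mult.commute)
  \<comment> \<open>The first term covers \<open>h\<close> about \<open>t / 3\<close>, the second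
    the capped case. The second is so small that \<open>10 ^ 10 * x\<close> stays bounded by a
    constant when \<open>y\<close> is negligible, which is the \<open>+ 1\<close> in the
    communication bound.\<close>
  have h: "0 < h \<and> x \<le> 16 * y + 4 / 10 ^ 12"
  proof (cases "t div 3 \<le> nat \<lfloor>10 ^ 6 * N\<rfloor>")
    case True
    then have "h = t div 3" by (simp add: h_def)
    then have "t \<le> 3 * h + 2" by linarith
    then have "real t \<le> 3 * real h + 2" by linarith
    then have ht: "real t / 4 \<le> real h" using t4 by linarith
    then have "N / real h \<le> N / (real t / 4)"
      using N t4 by (intro divide_left_mono mult_pos_pos) auto
    then have "x \<le> (N / (real t / 4))\<^sup>2" unfolding x_def using N by (intro power_mono) auto
    also have "\<dots> = 16 * y" by (simp add: yN power_divide power_mult_distrib)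
    finally show ?thesis using ht t4 by simp
  next
    case False
    then have "h = nat \<lfloor>10 ^ 6 * N\<rfloor>" by (simp add: h_def)
    then have "10 ^ 6 * N - 1 < real h" using N by linarith
    then have hN: "10 ^ 6 / 2 * N \<le> real h" using N by simp
    then have "N / real h \<le> N / (10 ^ 6 / 2 * N)"
      using N by (intro divide_left_mono mult_pos_pos) auto
    then have "x \<le> (N / (10 ^ 6 / 2 * N))\<^sup>2" unfolding x_def using N by (intro power_mono) auto
    also have "\<dots> = 4 / 10 ^ 12" using N by (simp add: power_divide)
    finally show ?thesis using hN N y0 by simp
  qed
  then have hpos: "0 < h" and x_le: "x \<le> 16 * y + 4 / 10 ^ 12" by auto
  have x0: "0 < x" unfolding x_def using hpos N by simp
  define k where "k = nat \<lceil>10 ^ 10 * x\<rceil>"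
  have k_ge: "10 ^ 10 * x \<le> real k" unfolding k_def by (rule real_nat_ceiling_ge)
  have k_less: "real k < 10 ^ 10 * x + 1" unfolding k_def by (rule real_nat_ceiling_less) (use x0 in simp)
  have "0 < 10 ^ 10 * x" using x0 by simp
  then have "0 < real k" using k_ge by (rule less_le_trans)
  then have k1: "1 \<le> k" by simp
  have k_y: "real k \<le> 2 + 16 * 10 ^ 10 * y" using k_less x_le by simp
  have "3 * real k \<le> real t" using k_y yt t4 by simp
  then have "k \<le> t div 3" by linarith
  moreover have "h \<le> t div 3" by (simp add: h_def)
  ultimately have ct: "k + h + h \<le> t" by linarith
  \<comment> \<open>The constant \<open>10 ^ 6\<close> in the sample size enters here through
    \<open>y \<le> n / 10 ^ 12\<close>: flattening increases \<open>n\<close> only by a constant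
    factor.\<close>
  have "real k \<le> 2 * real n" using k_less x_le yn n by simp

  \<comment> \<open>The factor 5 stems from \<open>n + 2 * k \<le> 5 * n\<close>.\<close>
  define \<tau> where "\<tau> = \<epsilon>\<^sup>2 / (5 * real n)"
  have \<tau>: "0 < \<tau>" using \<epsilon> n by (simp add: \<tau>_def)
  have "\<tau> * (real n + 2 * real k) \<le> \<tau> * (5 * real n)"
    using \<open>real k \<le> 2 * real n\<close> \<tau> by (intro mult_left_mono) auto
  also have "\<dots> = \<epsilon>\<^sup>2" using n by (simp add: \<tau>_def)
  finally have \<tau>2: "\<tau> * (real n + 2 * real k) \<le> \<epsilon>\<^sup>2" .
  have "real h * \<tau> = real h / (5 * N)" using \<epsilon> by (simp add: \<tau>_def N_def field_simps)
  then have h\<tau>: "(real h * \<tau>)\<^sup>2 = 1 / (25 * x)" by (simp add: x_def power_divide power_mult_distrib)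
  \<comment> \<open>The constant is \<open>10 ^ 10 / 25\<close>; even after division by
    \<open>1200 ^ 2\<close> it exceeds \<open>96\<close>.\<close>
  have kx: "400000000 \<le> real k * (1 / (25 * x))"
    using k_ge x0 by (simp add: field_simps)
  have m: "10000 \<le> 10000 * k" "76800 \<le> real (10000 * k) * (real h * \<tau>)\<^sup>2"
    using k1 kx unfolding h\<tau> by simp_all
  have kk: "96 \<le> (real k + 1) * (real h * \<tau> / 1200)\<^sup>2"
  proof -
    have "96 \<le> 400000000 / (1440000 :: real)" by simp
    also have "\<dots> \<le> real k * (1 / (25 * x)) / 1440000" using kx by (rule divide_right_mono) simp
    also have "\<dots> \<le> (real k + 1) * (1 / (25 * x)) / 1440000"
      using x0 by (intro divide_right_mono mult_right_mono) auto
    finally show ?thesis unfolding power_divide h\<tau> by simp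
  qed

  \<comment> \<open>Both conditions on \<open>l\<close> reduce to powers of \<open>r\<close>, since
    \<open>n \<le> 2 * r\<close> and \<open>n * N = r ^ 2\<close>.\<close>
  define r where "r = real n / \<epsilon>"
  have r1: "1 \<le> r" and nr: "real n \<le> 2 * r"
    using n \<epsilon> by (simp_all add: r_def field_simps)
  obtain l :: nat where l: "10 ^ 8 * r ^ 3 < 2 ^ l" "1 \<le> l" "real l \<le> 28 * (1 + ln r)"
    using power_two_exceeds[OF r1] .
  have "real n ^ 3 \<le> (2 * r) ^ 3" using nr by (intro power_mono) auto
  also have "\<dots> \<le> 10 ^ 8 * r ^ 3" using r1 by (simp add: power_mult_distrib)
  also have "\<dots> < 2 ^ l" by (fact l(1))
  finally have "real (n ^ 3) < real (2 ^ l)" by simp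
  then have l1: "n ^ 3 < 2 ^ l" by (simp only: of_nat_less_iff)
  have "2 * ((1 + 2 * real k) * real h) + 1 \<le> 2 * ((5 * real n) * (10 ^ 6 * N)) + 1"
    using \<open>real k \<le> 2 * real n\<close> n N h_le
    by (intro add_right_mono mult_left_mono mult_mono) auto
  also have "\<dots> = 10 ^ 7 * r ^ 2 + 1" by (simp add: N_def r_def power2_eq_square)
  also have "\<dots> \<le> 10 ^ 8 * r ^ 3"
  proof -
    have "1 \<le> r ^ 2" using r1 by simp
    moreover have "r ^ 2 \<le> r ^ 3" using r1 by (intro power_increasing) auto
    ultimately show ?thesis by simp
  qed
  also have "\<dots> < 2 ^ l" by (fact l(1))
  finally have "real (2 * ((1 + 2 * k) * h) + 1) \<le> real (2 ^ l)" by (simp add: algebra_simps)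
  then have l2: "2 * ((1 + 2 * k) * h) + 1 \<le> 2 ^ l" by (simp only: of_nat_le_iff)

  obtain RA RB P where P: "solves_CT n t \<epsilon> RA RB P"
    and cost: "comm_cost P \<le> l * k + ((l * k + 3 * l * (10000 * k)) + 1)"
    using protocol_exists[OF ct l1 l2 m kk \<tau> \<tau>2 hpos \<epsilon>(1)] by blast
  \<comment> \<open>Absorbs the answer bit into the product \<open>l * k\<close>.\<close>
  have "1 \<le> l * k" using l(2) k1 by simp
  moreover have "comm_cost P \<le> 30002 * (l * k) + 1" using cost by (simp add: algebra_simps)
  ultimately have "comm_cost P \<le> 30003 * (l * k)" by linarith
  then have "real (comm_cost P) \<le> 30003 * (real l * real k)"
    by (metis of_nat_le_iff of_nat_mult of_nat_numeral)
  also have "\<dots> \<le> 30003 * ((28 * (1 + ln r)) * (2 * 10 ^ 11 * (y + 1)))"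
    using l(3) k_y y0 r1 by (intro mult_left_mono mult_mono) auto
  also have "\<dots> = (30003 * 28 * 2 * 10 ^ 11) * ((1 + ln r) * (y + 1))"
    by (simp add: algebra_simps)
  also have "\<dots> \<le> 10 ^ 18 * ((1 + ln r) * (y + 1))"
    using r1 y0 by (intro mult_right_mono) auto
  finally have "real (comm_cost P) \<le> 10 ^ 18 * (1 + ln (real n / \<epsilon>)) * (y + 1)"
    by (simp only: r_def mult.assoc)
  with P show ?thesis unfolding CT_solvable_with_def y_def by blast
qed

text \<open>The soft-O is read as a fixed power of \<open>1 + ln (n / \<epsilon>)\<close>, which is
  at least 1 since \<open>n / \<epsilon> \<ge> 1\<close>. All constants are uniform in
  \<open>n\<close>, \<open>\<epsilon>\<close> and \<open>t\<close>, and the first power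
  suffices.\<close>

theorem mainTheorem5:
  shows "\<exists>C > (0::real). \<exists>K > (0::real). \<exists>k :: nat.
    \<forall>(n :: nat) (\<epsilon> :: real) (t :: nat).
      n > 1 \<longrightarrow> 0 < \<epsilon> \<longrightarrow> \<epsilon> \<le> 2 \<longrightarrow>
      real t \<ge> C * max (real n powr (2 / 3) * \<epsilon> powr (- 4 / 3)) (sqrt (real n) / \<epsilon> ^ 2) \<longrightarrow>
      CT_solvable_with n t \<epsilon>
        (K * (1 + ln (real n / \<epsilon>)) ^ k * (real n ^ 2 / (real t ^ 2 * \<epsilon> ^ 4) + 1))"
proof (intro exI conjI)
  show "\<forall>(n :: nat) (\<epsilon> :: real) (t :: nat).
      n > 1 \<longrightarrow> 0 < \<epsilon> \<longrightarrow> \<epsilon> \<le> 2 \<longrightarrow>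
      real t \<ge> 10 ^ 6 * max (real n powr (2 / 3) * \<epsilon> powr (- 4 / 3)) (sqrt (real n) / \<epsilon> ^ 2) \<longrightarrow>
      CT_solvable_with n t \<epsilon>
        (10 ^ 18 * (1 + ln (real n / \<epsilon>)) ^ 1 * (real n ^ 2 / (real t ^ 2 * \<epsilon> ^ 4) + 1))"
    using CT_solvable by simp
qed simp_all

end
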